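(* Let $d$ be a positive integer and let $\varphi:[0,1]^d\to\mathbb{R}^d$ be such that, for $x=(x_1,\dots,x_d)$, $$\varphi(x)=\bigl(x_1+l_1(x_2,\dots,x_d),\;x_2+l_2(x_3,\dots,x_d),\;\dots,\;x_{d-1}+l_{d-1}(x_d),\;x_d\bigr)$$ for some real-valued $C^1$-functions $l_1,l_2,\dots,l_{d-1}$, where $l_j$ is a function on $[0,1]^{d-j}$. Then $E(\mathbb{Z}^d,\varphi)=\{e^{2\pi i k\cdot\varphi(x)}:k\in\mathbb{Z}^d\}$ is an orthonormal basis for $L^2([0,1]^d)$.
   Context: $L^2([0,1]^d)$ is taken with respect to Lebesgue measure. For $d=1$ there are no functions $l_j$ and $\varphi(x)=x$. *)

theory Defs
  imports "HOL-Analysis.Analysis"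
begin

text \<open>
  A point of \<open>\<real>\<^sup>I\<close>, for a finite set \<open>I\<close> of coordinate indices, is a function on \<^typ>\<open>nat\<close>
  that is \<^const>\<open>undefined\<close> off \<open>I\<close>.  On such points the product topology of
  \<^typ>\<open>nat \<Rightarrow> real\<close> is the Euclidean one.  The cube \<open>[0,1]\<^sup>d\<close> is \<open>unit_cube {1..d}\<close>, and the
  space \<open>[0,1]\<^bsup>d-j\<^esup>\<close> of the variables \<open>x\<^sub>j\<^sub>+\<^sub>1, \<dots>, x\<^sub>d\<close> is \<open>unit_cube {j+1..d}\<close>.
\<close>

definition unit_cube :: "nat set \<Rightarrow> (nat \<Rightarrow> real) set" where
  "unit_cube I = (\<Pi>\<^sub>E i\<in>I. {0..1})"

text \<open>
  \<open>C\<^sup>1\<close> on the closed cube: the first-order partial derivatives exist everywhere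
  (one-sided on the faces) and are continuous on the closed cube.
\<close>

definition C1_on_cube :: "nat set \<Rightarrow> ((nat \<Rightarrow> real) \<Rightarrow> real) \<Rightarrow> bool" where
  "C1_on_cube I f \<longleftrightarrow>
    (\<exists>D. \<forall>i\<in>I. continuous_on (unit_cube I) (D i) \<and>
      (\<forall>x\<in>unit_cube I.
        ((\<lambda>t. f (x(i := t))) has_real_derivative D i x) (at (x i) within {0..1})))"

text \<open>
  Lebesgue measure on \<open>[0,1]\<^sup>I\<close>; the completion makes all Lebesgue measurable sets,
  not only the Borel ones, measurable.
\<close>

definition cube_lebesgue :: "nat set \<Rightarrow> (nat \<Rightarrow> real) measure" where
  "cube_lebesgue I = completion (\<Pi>\<^sub>M i\<in>I. restrict_space lborel {0..1})"

text \<open>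
  Elements of \<open>L\<^sup>2(M)\<close> are handled through representatives: \<open>L2_norm M (f - g) = 0\<close> is equality
  almost everywhere, and nothing below distinguishes functions that agree almost everywhere.
\<close>

definition L2_space :: "'a measure \<Rightarrow> ('a \<Rightarrow> complex) set" where
  "L2_space M = {f \<in> borel_measurable M. integrable M (\<lambda>x. (cmod (f x))\<^sup>2)}"

definition L2_inner :: "'a measure \<Rightarrow> ('a \<Rightarrow> complex) \<Rightarrow> ('a \<Rightarrow> complex) \<Rightarrow> complex" where
  "L2_inner M f g = (LINT x|M. f x * cnj (g x))"

definition L2_norm :: "'a measure \<Rightarrow> ('a \<Rightarrow> complex) \<Rightarrow> real" where
  "L2_norm M f = sqrt (LINT x|M. (cmod (f x))\<^sup>2)"

text \<open>
  An orthonormal basis is an orthonormal system whose linear span is dense.  It is given as a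
  family indexed by \<open>K\<close>, so that distinct indices must give distinct elements of \<open>L\<^sup>2(M)\<close>.
\<close>

definition L2_orthonormal :: "'a measure \<Rightarrow> 'k set \<Rightarrow> ('k \<Rightarrow> 'a \<Rightarrow> complex) \<Rightarrow> bool" where
  "L2_orthonormal M K e \<longleftrightarrow>
    (\<forall>k\<in>K. e k \<in> L2_space M) \<and>
    (\<forall>k\<in>K. \<forall>m\<in>K. L2_inner M (e k) (e m) = (if k = m then 1 else 0))"

definition L2_orthonormal_basis :: "'a measure \<Rightarrow> 'k set \<Rightarrow> ('k \<Rightarrow> 'a \<Rightarrow> complex) \<Rightarrow> bool" where
  "L2_orthonormal_basis M K e \<longleftrightarrow>
    L2_orthonormal M K e \<and>
    (\<forall>f\<in>L2_space M. \<forall>\<epsilon>>0. \<exists>F c. finite F \<and> F \<subseteq> K \<and>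
      L2_norm M (\<lambda>x. f x - (\<Sum>k\<in>F. c k * e k x)) < \<epsilon>)"

text \<open>Being extensional, each element of \<open>\<int>\<^sup>d\<close> is represented exactly once.\<close>

definition int_lattice :: "nat \<Rightarrow> (nat \<Rightarrow> int) set" where
  "int_lattice d = (\<Pi>\<^sub>E j\<in>{1..d}. UNIV)"

text \<open>The member \<open>e\<^bsup>2 \<pi> i k \<cdot> \<phi>(x)\<^esup>\<close> of the system \<open>E(\<Lambda>, \<phi>)\<close>.\<close>

definition E_fun ::
  "nat \<Rightarrow> ((nat \<Rightarrow> real) \<Rightarrow> nat \<Rightarrow> real) \<Rightarrow> (nat \<Rightarrow> int) \<Rightarrow> (nat \<Rightarrow> real) \<Rightarrow> complex" where
  "E_fun d \<phi> k x = exp (2 * of_real pi * \<i> * of_real (\<Sum>j=1..d. of_int (k j) * \<phi> x j))"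

end

theory Submission
  imports Defs "HOL-Probability.Infinite_Product_Measure"
begin

text \<open>
  Write \<open>e(t) = e\<^bsup>2 \<pi> i t\<^esup>\<close>.  The coordinate \<open>x\<^sub>1\<close> enters \<open>e(k \<cdot> \<phi>(x))\<close> only through the factor
  \<open>e(k\<^sub>1 x\<^sub>1)\<close>, so with \<open>y = (x\<^sub>2, \<dots>, x\<^sub>d)\<close> the mode factors as
  \<open>e(k\<^sub>1 x\<^sub>1) \<cdot> e(k\<^sub>1 l\<^sub>1(y)) \<cdot> g(y)\<close>, where \<open>g\<close> is a mode of the same kind in the variables \<open>y\<close>, and
  the middle factor, the only trace of \<open>l\<^sub>1\<close>, is unimodular and free of \<open>x\<^sub>1\<close>.  Both
  halves of the claim follow by adding the coordinates \<open>x\<^sub>d, x\<^bsub>d-1\<^esub>, \<dots>, x\<^sub>1\<close> one at a time.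

  Orthonormality (\<open>integral_shear_mode\<close>): the product of one mode with the conjugate of another
  is the mode of the difference frequency, so it suffices to integrate a single mode.
  Integrating over \<open>x\<^sub>1\<close> first gives \<open>0\<close> unless \<open>k\<^sub>1 = 0\<close>, and for \<open>k\<^sub>1 = 0\<close> the twisting factor is
  \<open>1\<close> and a mode in fewer variables remains.

  Density (\<open>L2_total_twisted\<close>): to approximate \<open>1\<^bsub>A\<^esub>(y) 1\<^bsub>B\<^esub>(x\<^sub>1)\<close>, replace \<open>1\<^bsub>B\<^esub>\<close> by a trigonometric
  polynomial, and for each of its frequencies \<open>m\<close> approximate the function
  \<open>1\<^bsub>A\<^esub>(y) e(-m l\<^sub>1(y))\<close>, which is again square integrable in \<open>y\<close>, by modes in \<open>y\<close>.  Multiplying back by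
  the unimodular \<open>e(m l\<^sub>1(y)) e(m x\<^sub>1)\<close> preserves the error.  Since rectangles are an
  intersection-stable generator, a Dynkin class argument and simple functions
  (\<open>L2_closure_indicators\<close>, \<open>L2_closure_eq_L2\<close>) then reach all of \<open>L\<^sup>2\<close>.

  In one variable, density is the Stone--Weierstrass theorem on the circle
  (\<open>L2_total_fourier\<close>).  Bounded partial derivatives make the \<open>l\<^sub>j\<close> Lipschitz, hence
  measurable (\<open>C1_on_cube_measurable\<close>), which makes the twisting factors measurable.
\<close>

section \<open>Closed linear spans in \<open>L\<^sup>2\<close>\<close>

text \<open>
  Distances are measured by the square of the norm, as a nonnegative Lebesgue integral.
  With values in \<^typ>\<open>ennreal\<close>, no integrability conditions arise, and Tonelli's theorem applies
  directly.
\<close>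

definition sq_norm :: "'a measure \<Rightarrow> ('a \<Rightarrow> complex) \<Rightarrow> ennreal" where
  "sq_norm M f = (\<integral>\<^sup>+x. ennreal ((cmod (f x))\<^sup>2) \<partial>M)"

inductive_set lin_span :: "('a \<Rightarrow> complex) set \<Rightarrow> ('a \<Rightarrow> complex) set"
  for E where
  zero: "(\<lambda>x. 0) \<in> lin_span E"
| step: "g \<in> lin_span E \<Longrightarrow> e \<in> E \<Longrightarrow> (\<lambda>x. g x + c * e x) \<in> lin_span E"

definition L2_closure :: "'a measure \<Rightarrow> ('a \<Rightarrow> complex) set \<Rightarrow> ('a \<Rightarrow> complex) set" where
  "L2_closure M E = {f \<in> borel_measurable M.
     \<forall>r>0. \<exists>g\<in>lin_span E. sq_norm M (\<lambda>x. f x - g x) \<le> ennreal r}"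

lemma lin_span_base: "e \<in> E \<Longrightarrow> e \<in> lin_span E"
  using lin_span.step[OF lin_span.zero, of e E 1] by simp

lemma lin_span_scale: "g \<in> lin_span E \<Longrightarrow> (\<lambda>x. a * g x) \<in> lin_span E"
proof (induction rule: lin_span.induct)
  case (step g e c)
  from lin_span.step[OF step.IH step.hyps(2), of "a * c"] show ?case
    by (simp add: algebra_simps)
qed (simp add: lin_span.zero)

lemma lin_span_add:
  assumes "g \<in> lin_span E" "h \<in> lin_span E"
  shows "(\<lambda>x. g x + h x) \<in> lin_span E"
  using assms(2)
proof (induction rule: lin_span.induct)
  case (step h e c)
  from lin_span.step[OF step.IH step.hyps(2), of c] show ?case
    by (simp add: algebra_simps)
qed (simp add: assms(1))

lemma lin_span_measurable:
  assumes "E \<subseteq> borel_measurable M" "g \<in> lin_span E"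
  shows "g \<in> borel_measurable M"
  using assms(2) by (induction rule: lin_span.induct) (use assms(1) in auto)

lemma lin_span_image:
  "g \<in> lin_span (e ` K) \<Longrightarrow> \<exists>F c. finite F \<and> F \<subseteq> K \<and> g = (\<lambda>x. \<Sum>k\<in>F. c k * e k x)"
proof (induction rule: lin_span.induct)
  case zero
  show ?case by (intro exI[of _ "{}"]) auto
next
  case (step g f a)
  then obtain F c k where F: "finite F" "F \<subseteq> K" "g = (\<lambda>x. \<Sum>k\<in>F. c k * e k x)"
    and k: "k \<in> K" "f = e k" by blast
  (* The index k may already occur in F; then the two coefficients add up. *)
  define c' where "c' j = (if j \<in> F then c j else 0) + (if j = k then a else 0)" for j
  have "(\<Sum>j\<in>insert k F. c' j * e j x) = (\<Sum>j\<in>F. c j * e j x) + a * e k x" for x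
  proof -
    have "(\<Sum>j\<in>insert k F. c' j * e j x) =
        (\<Sum>j\<in>insert k F. (if j \<in> F then c j * e j x else 0) + (if j = k then a * e j x else 0))"
      by (intro sum.cong) (auto simp: c'_def algebra_simps)
    also have "\<dots> = (\<Sum>j\<in>insert k F. if j \<in> F then c j * e j x else 0) + a * e k x"
      using F(1) by (simp add: sum.distrib)
    also have "(\<Sum>j\<in>insert k F. if j \<in> F then c j * e j x else 0) = (\<Sum>j\<in>F. c j * e j x)"
      using F(1) by (intro sum.mono_neutral_cong_right) auto
    finally show ?thesis .
  qed
  then show ?case
    using F k by (intro exI[of _ "insert k F"] exI[of _ c']) auto
qed

text \<open>
  The factor \<open>2\<close> replaces Minkowski's inequality: approximation arguments only need that small
  plus small is small.
\<close>

lemma sq_norm_add_le: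
  assumes [measurable]: "f \<in> borel_measurable M" "g \<in> borel_measurable M"
  shows "sq_norm M (\<lambda>x. f x + g x) \<le> 2 * sq_norm M f + 2 * sq_norm M g"
proof -
  have *: "(cmod (a + b))\<^sup>2 \<le> 2 * (cmod a)\<^sup>2 + 2 * (cmod b)\<^sup>2" for a b
  proof -
    have "(cmod (a + b))\<^sup>2 \<le> (cmod a + cmod b)\<^sup>2"
      by (intro power_mono norm_triangle_ineq) auto
    also have "\<dots> \<le> 2 * (cmod a)\<^sup>2 + 2 * (cmod b)\<^sup>2"
      using zero_le_power2[of "cmod a - cmod b"] by (simp add: power2_eq_square algebra_simps)
    finally show ?thesis .
  qed
  have "sq_norm M (\<lambda>x. f x + g x) \<le>
      (\<integral>\<^sup>+x. 2 * ennreal ((cmod (f x))\<^sup>2) + 2 * ennreal ((cmod (g x))\<^sup>2) \<partial>M)"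
    unfolding sq_norm_def
  proof (rule nn_integral_mono)
    fix x
    have "ennreal ((cmod (f x + g x))\<^sup>2) \<le> ennreal (2 * (cmod (f x))\<^sup>2 + 2 * (cmod (g x))\<^sup>2)"
      using * by (rule ennreal_leI)
    then show "ennreal ((cmod (f x + g x))\<^sup>2) \<le>
        2 * ennreal ((cmod (f x))\<^sup>2) + 2 * ennreal ((cmod (g x))\<^sup>2)"
      by (simp add: ennreal_mult)
  qed
  also have "\<dots> = 2 * sq_norm M f + 2 * sq_norm M g"
    unfolding sq_norm_def by (simp add: nn_integral_add nn_integral_cmult)
  finally show ?thesis .
qed

lemma sq_norm_cmult:
  assumes [measurable]: "f \<in> borel_measurable M"
  shows "sq_norm M (\<lambda>x. a * f x) = ennreal ((cmod a)\<^sup>2) * sq_norm M f"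
  unfolding sq_norm_def
  by (simp add: norm_mult power_mult_distrib ennreal_mult nn_integral_cmult)

lemma sq_norm_cong_AE: "AE x in M. f x = g x \<Longrightarrow> sq_norm M f = sq_norm M g"
  unfolding sq_norm_def by (intro nn_integral_cong_AE) (auto elim!: eventually_mono)

lemma L2_closureD: "f \<in> L2_closure M E \<Longrightarrow> f \<in> borel_measurable M"
  by (simp add: L2_closure_def)

lemma lin_span_in_closure:
  assumes "E \<subseteq> borel_measurable M" "g \<in> lin_span E"
  shows "g \<in> L2_closure M E"
proof -
  have "\<exists>h\<in>lin_span E. sq_norm M (\<lambda>x. g x - h x) \<le> ennreal r" if "r > 0" for r
    by (rule bexI[OF _ assms(2)]) (simp add: sq_norm_def)
  then show ?thesis
    using lin_span_measurable[OF assms] by (simp add: L2_closure_def)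
qed

text \<open>
  Taking the closure twice gives nothing new: an approximant in the closure may itself be
  replaced by an element of the span.
\<close>

lemma L2_closure_closed:
  assumes E: "E \<subseteq> borel_measurable M"
    and f[measurable]: "f \<in> borel_measurable M"
    and lim: "\<And>r. r > 0 \<Longrightarrow> \<exists>h\<in>L2_closure M E. sq_norm M (\<lambda>x. f x - h x) \<le> ennreal r"
  shows "f \<in> L2_closure M E"
proof -
  have "\<exists>g\<in>lin_span E. sq_norm M (\<lambda>x. f x - g x) \<le> ennreal r" if "r > 0" for r
  proof -
    (* Two errors of r/4, each doubled by the weak triangle inequality, add up to r. *)
    from lim[of "r/4"] that obtain h where h: "h \<in> L2_closure M E"
      "sq_norm M (\<lambda>x. f x - h x) \<le> ennreal (r/4)" by auto
    have [measurable]: "h \<in> borel_measurable M" using h(1) by (rule L2_closureD)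
    have "0 < r/4" using that by simp
    with h(1) obtain g where g: "g \<in> lin_span E" "sq_norm M (\<lambda>x. h x - g x) \<le> ennreal (r/4)"
      unfolding L2_closure_def by blast
    have [measurable]: "g \<in> borel_measurable M" by (rule lin_span_measurable[OF E g(1)])
    have "sq_norm M (\<lambda>x. (f x - h x) + (h x - g x)) \<le>
        2 * sq_norm M (\<lambda>x. f x - h x) + 2 * sq_norm M (\<lambda>x. h x - g x)"
      by (rule sq_norm_add_le) measurable
    also have "\<dots> \<le> 2 * ennreal (r/4) + 2 * ennreal (r/4)"
      by (intro add_mono mult_left_mono h g) auto
    also have "\<dots> = ennreal (2 * (r/4) + 2 * (r/4))"
      using that by (simp only: ennreal_mult ennreal_plus flip: ennreal_numeral)
    finally show ?thesis using g(1) that by (intro bexI[of _ g]) simp_all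
  qed
  then show ?thesis using f by (simp add: L2_closure_def)
qed

lemma L2_closure_add:
  assumes E: "E \<subseteq> borel_measurable M"
    and f: "f \<in> L2_closure M E" and g: "g \<in> L2_closure M E"
  shows "(\<lambda>x. f x + g x) \<in> L2_closure M E"
proof -
  have [measurable]: "f \<in> borel_measurable M" "g \<in> borel_measurable M"
    using f g by (auto dest: L2_closureD)
  have "\<exists>h\<in>lin_span E. sq_norm M (\<lambda>x. f x + g x - h x) \<le> ennreal r" if "r > 0" for r
  proof -
    have "0 < r/4" using that by simp
    then obtain f' g' where f': "f' \<in> lin_span E" "sq_norm M (\<lambda>x. f x - f' x) \<le> ennreal (r/4)"
      and g': "g' \<in> lin_span E" "sq_norm M (\<lambda>x. g x - g' x) \<le> ennreal (r/4)"
      using f g unfolding L2_closure_def by blast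
    have [measurable]: "f' \<in> borel_measurable M" "g' \<in> borel_measurable M"
      using f' g' lin_span_measurable[OF E] by auto
    have "sq_norm M (\<lambda>x. (f x - f' x) + (g x - g' x)) \<le>
        2 * sq_norm M (\<lambda>x. f x - f' x) + 2 * sq_norm M (\<lambda>x. g x - g' x)"
      by (rule sq_norm_add_le) measurable
    also have "\<dots> \<le> 2 * ennreal (r/4) + 2 * ennreal (r/4)"
      by (intro add_mono mult_left_mono f' g') auto
    also have "\<dots> = ennreal (2 * (r/4) + 2 * (r/4))"
      using that by (simp only: ennreal_mult ennreal_plus flip: ennreal_numeral)
    finally show ?thesis using lin_span_add[OF f'(1) g'(1)] that
      by (intro bexI[of _ "\<lambda>x. f' x + g' x"]) (simp_all add: algebra_simps)
  qed
  then show ?thesis by (simp add: L2_closure_def)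
qed

lemma L2_closure_scale:
  assumes E: "E \<subseteq> borel_measurable M" and f: "f \<in> L2_closure M E"
  shows "(\<lambda>x. a * f x) \<in> L2_closure M E"
proof -
  have [measurable]: "f \<in> borel_measurable M" using f by (rule L2_closureD)
  have "\<exists>h\<in>lin_span E. sq_norm M (\<lambda>x. a * f x - h x) \<le> ennreal r" if "r > 0" for r
  proof -
    (* The summand 1 in the denominator covers a = 0. *)
    define s where "s = r / (1 + (cmod a)\<^sup>2)"
    have pos: "1 + (cmod a)\<^sup>2 > 0" by (simp add: add_pos_nonneg)
    then have "s > 0" using that by (simp add: s_def)
    then obtain g where g: "g \<in> lin_span E" "sq_norm M (\<lambda>x. f x - g x) \<le> ennreal s"
      using f unfolding L2_closure_def by blast
    have [measurable]: "g \<in> borel_measurable M" using g lin_span_measurable[OF E] by auto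
    have "sq_norm M (\<lambda>x. a * (f x - g x)) \<le> ennreal ((cmod a)\<^sup>2) * ennreal s"
      by (subst sq_norm_cmult) (auto intro!: mult_left_mono g)
    also have "\<dots> = ennreal ((cmod a)\<^sup>2 * s)" using \<open>s > 0\<close> by (simp add: ennreal_mult)
    also have "\<dots> \<le> ennreal r"
    proof (rule ennreal_leI)
      have "(cmod a)\<^sup>2 * s \<le> (1 + (cmod a)\<^sup>2) * s" using \<open>s > 0\<close> by (intro mult_right_mono) auto
      also have "\<dots> = r" using pos by (simp add: s_def)
      finally show "(cmod a)\<^sup>2 * s \<le> r" .
    qed
    finally show ?thesis using lin_span_scale[OF g(1), of a]
      by (intro bexI[of _ "\<lambda>x. a * g x"]) (simp_all add: algebra_simps)
  qed
  then show ?thesis by (simp add: L2_closure_def)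
qed

lemma L2_closure_sum:
  assumes E: "E \<subseteq> borel_measurable M" and "\<And>i. i \<in> S \<Longrightarrow> f i \<in> L2_closure M E"
  shows "(\<lambda>x. \<Sum>i\<in>S. f i x) \<in> L2_closure M E"
  using assms(2)
proof (induction S rule: infinite_finite_induct)
  case (insert i S)
  then show ?case by (simp add: L2_closure_add[OF E])
qed (simp_all add: lin_span_in_closure[OF E lin_span.zero])

lemma L2_closure_cong_AE:
  assumes f: "f \<in> L2_closure M E" and "g \<in> borel_measurable M" and eq: "AE x in M. f x = g x"
  shows "g \<in> L2_closure M E"
proof -
  have "sq_norm M (\<lambda>x. f x - h x) = sq_norm M (\<lambda>x. g x - h x)" for h
    using eq by (intro sq_norm_cong_AE) (auto elim!: eventually_mono)
  with assms show ?thesis by (simp add: L2_closure_def)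
qed

lemma L2_closure_dominated:
  fixes u :: "nat \<Rightarrow> 'a \<Rightarrow> complex"
  assumes E: "E \<subseteq> borel_measurable M"
    and f[measurable]: "f \<in> borel_measurable M"
    and u: "\<And>n. u n \<in> L2_closure M E"
    and w[measurable]: "w \<in> borel_measurable M" and w_fin: "(\<integral>\<^sup>+x. ennreal ((w x)\<^sup>2) \<partial>M) < \<infinity>"
    and bound: "\<And>n x. x \<in> space M \<Longrightarrow> cmod (f x - u n x) \<le> w x"
    and lim: "\<And>x. x \<in> space M \<Longrightarrow> (\<lambda>n. u n x) \<longlonglongrightarrow> f x"
  shows "f \<in> L2_closure M E"
proof (rule L2_closure_closed[OF E f])
  have [measurable]: "\<And>n. u n \<in> borel_measurable M" using u by (rule L2_closureD)
  have "(\<lambda>n. sq_norm M (\<lambda>x. f x - u n x)) \<longlonglongrightarrow> (\<integral>\<^sup>+x. 0 \<partial>M)"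
    unfolding sq_norm_def
  proof (rule nn_integral_dominated_convergence[where w = "\<lambda>x. ennreal ((w x)\<^sup>2)"])
    show "AE x in M. ennreal ((cmod (f x - u n x))\<^sup>2) \<le> ennreal ((w x)\<^sup>2)" for n
      using bound by (intro AE_I2 ennreal_leI power_mono) auto
    show "AE x in M. (\<lambda>n. ennreal ((cmod (f x - u n x))\<^sup>2)) \<longlonglongrightarrow> 0"
    proof (rule AE_I2)
      fix x assume "x \<in> space M"
      from tendsto_diff[OF tendsto_const[of "f x"] lim[OF this]]
      have "(\<lambda>n. f x - u n x) \<longlonglongrightarrow> 0" by simp
      then have "(\<lambda>n. (cmod (f x - u n x))\<^sup>2) \<longlonglongrightarrow> 0"
        using tendsto_power[OF tendsto_norm, of _ 0 sequentially 2] by force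
      then show "(\<lambda>n. ennreal ((cmod (f x - u n x))\<^sup>2)) \<longlonglongrightarrow> 0"
        using tendsto_ennrealI by fastforce
    qed
  qed (use w_fin in auto)
  then have lim0: "(\<lambda>n. sq_norm M (\<lambda>x. f x - u n x)) \<longlonglongrightarrow> 0" by simp
  fix r :: real assume "r > 0"
  then have "0 < ennreal r" by simp
  from order_tendstoD(2)[OF lim0 this] obtain n where "sq_norm M (\<lambda>x. f x - u n x) < ennreal r"
    by (auto simp: eventually_sequentially)
  then show "\<exists>h\<in>L2_closure M E. sq_norm M (\<lambda>x. f x - h x) \<le> ennreal r"
    using u by (intro bexI[of _ "u n"]) auto
qed

text \<open>
  The sets whose indicators can be approximated form a Dynkin class: complements come from
  \<open>1 - 1\<^bsub>A\<^esub>\<close>, and countable disjoint unions from dominated convergence of the partial sums.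
\<close>

lemma L2_closure_indicators:
  assumes fin: "finite_measure M" and E: "E \<subseteq> borel_measurable M"
    and gen: "sets M = sigma_sets (space M) G" and G: "Int_stable G" "G \<subseteq> Pow (space M)"
    and one: "(\<lambda>x. 1) \<in> L2_closure M E"
    and ind: "\<And>A. A \<in> G \<Longrightarrow> indicator A \<in> L2_closure M E"
    and A: "A \<in> sets M"
  shows "indicator A \<in> L2_closure M E"
proof -
  interpret finite_measure M by fact
  have int_1: "(\<integral>\<^sup>+x. ennreal ((1::real)\<^sup>2) \<partial>M) < \<infinity>"
    using emeasure_finite[of "space M"] by (simp add: less_top[symmetric])
  have "A \<in> sigma_sets (space M) G" using A gen by simp
  with G show ?thesis
  proof (induction rule: sigma_sets_induct_disjoint)
    case empty
    have "indicator {} = (\<lambda>x::'a. 0::complex)" by (simp add: fun_eq_iff)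
    then show ?case using lin_span_in_closure[OF E lin_span.zero] by simp
  next
    case (compl A)
    have meas: "space M - A \<in> sets M" using compl gen by auto
    have "(\<lambda>x. 1 + (-1) * indicator A x) \<in> L2_closure M E"
      by (intro L2_closure_add[OF E] one L2_closure_scale[OF E] compl)
    then show ?case
      by (rule L2_closure_cong_AE) (use meas in \<open>auto intro!: AE_I2 split: split_indicator\<close>)
  next
    case (union A)
    have A: "A i \<in> sets M" for i using union gen by auto
    then have [measurable]: "(\<Union>i. A i) \<in> sets M" by auto
    show ?case
    proof (rule L2_closure_dominated[OF E _ _ _ int_1, where u = "\<lambda>n x. \<Sum>i<n. indicator (A i) x"])
      show "(\<lambda>x. \<Sum>i<n. indicator (A i) x) \<in> L2_closure M E" for n
        by (intro L2_closure_sum[OF E] union)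
      have eq: "(\<Sum>i<n. indicator (A i) x) = (indicator (\<Union>i<n. A i) x :: complex)" for n x
        using union(1) by (subst indicator_UN_disjoint) (auto simp: disjoint_family_on_def)
      show "cmod (indicator (\<Union>i. A i) x - (\<Sum>i<n. indicator (A i) x)) \<le> 1" for n x
        unfolding eq by (auto split: split_indicator)
      show "(\<lambda>n. \<Sum>i<n. indicator (A i) x) \<longlonglongrightarrow> (indicator (\<Union>i. A i) x :: complex)" for x
        unfolding eq by (rule LIMSEQ_indicator_UN)
    qed auto
  qed (use ind in auto)
qed

text \<open>
  Once indicators are available, so are simple functions, and a sequence of simple functions
  \<open>s\<^sub>i \<rightarrow> f\<close> with \<open>\<bar>s\<^sub>i\<bar> \<le> 2 \<bar>f\<bar>\<close> converges in \<open>L\<^sup>2\<close> with dominating function \<open>3 \<bar>f\<bar>\<close>.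
\<close>

lemma L2_closure_eq_L2:
  assumes E: "E \<subseteq> borel_measurable M"
    and ind: "\<And>A. A \<in> sets M \<Longrightarrow> indicator A \<in> L2_closure M E"
    and f[measurable]: "f \<in> borel_measurable M" and fin: "sq_norm M f < \<infinity>"
  shows "f \<in> L2_closure M E"
proof -
  from borel_measurable_implies_sequence_metric[OF f, of 0] obtain s where
    s: "\<And>i. simple_function M (s i)" and
    pointwise: "\<And>x. x \<in> space M \<Longrightarrow> (\<lambda>i. s i x) \<longlonglongrightarrow> f x" and
    bound: "\<And>i x. x \<in> space M \<Longrightarrow> norm (s i x) \<le> 2 * norm (f x)"
    by simp metis
  show ?thesis
  proof (rule L2_closure_dominated[OF E f, where u = s and w = "\<lambda>x. 3 * cmod (f x)"])
    fix i
    have sm: "s i \<in> borel_measurable M" by (rule borel_measurable_simple_function[OF s])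
    have "(\<lambda>x. \<Sum>y\<in>s i ` space M. y * indicator (s i -` {y} \<inter> space M) x) \<in> L2_closure M E"
      using s by (intro L2_closure_sum[OF E] L2_closure_scale[OF E] ind) (auto dest: simple_functionD(2))
    then show "s i \<in> L2_closure M E"
    proof (rule L2_closure_cong_AE[OF _ sm], intro AE_I2)
      fix x assume x: "x \<in> space M"
      have "(\<Sum>y\<in>s i ` space M. y * indicator (s i -` {y} \<inter> space M) x) =
          (\<Sum>y\<in>s i ` space M. if y = s i x then y else 0)"
        using x by (intro sum.cong) (auto split: split_indicator)
      also have "\<dots> = s i x" using x simple_functionD(1)[OF s] by simp
      finally show "(\<Sum>y\<in>s i ` space M. y * indicator (s i -` {y} \<inter> space M) x) = s i x" .
    qed
    fix x assume "x \<in> space M"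
    then show "cmod (f x - s i x) \<le> 3 * cmod (f x)"
      using norm_triangle_ineq4[of "f x" "s i x"] bound[of x i] by simp
  next
    have "(\<integral>\<^sup>+x. ennreal ((3 * cmod (f x))\<^sup>2) \<partial>M) = 9 * sq_norm M f"
      unfolding sq_norm_def by (simp add: power_mult_distrib ennreal_mult nn_integral_cmult)
    then show "(\<integral>\<^sup>+x. ennreal ((3 * cmod (f x))\<^sup>2) \<partial>M) < \<infinity>"
      using fin by (simp add: ennreal_mult_less_top)
  qed (use pointwise in auto)
qed

definition L2_total :: "'a measure \<Rightarrow> ('a \<Rightarrow> complex) set \<Rightarrow> bool" where
  "L2_total M E \<longleftrightarrow> E \<subseteq> borel_measurable M \<and>
    (\<forall>f\<in>borel_measurable M. sq_norm M f < \<infinity> \<longrightarrow> f \<in> L2_closure M E)"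

section \<open>Totality of twisted tensor products\<close>

text \<open>
  The products \<open>g(x) u\<^sub>k(x) e\<^sub>k(y)\<close>: an ordinary tensor product of two systems, except that the
  factor in \<open>x\<close> is twisted by \<open>u\<^sub>k\<close> depending on the index of the factor in \<open>y\<close>.
\<close>

definition twisted :: "('a \<Rightarrow> complex) set \<Rightarrow> ('k \<Rightarrow> 'a \<Rightarrow> complex) \<Rightarrow> ('k \<Rightarrow> 'b \<Rightarrow> complex)
    \<Rightarrow> ('a \<times> 'b \<Rightarrow> complex) set" where
  "twisted E u e = {\<lambda>z. g (fst z) * u k (fst z) * e k (snd z) | k g. g \<in> E}"

lemma (in sigma_finite_measure) sq_norm_tensor:
  assumes [measurable]: "f \<in> borel_measurable N" "g \<in> borel_measurable M"
  shows "sq_norm (N \<Otimes>\<^sub>M M) (\<lambda>z. f (fst z) * g (snd z)) = sq_norm N f * sq_norm M g"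
  unfolding sq_norm_def
  by (subst nn_integral_fst[symmetric])
    (simp_all add: norm_mult power_mult_distrib ennreal_mult nn_integral_cmult nn_integral_multc)

lemma (in prob_space) sq_norm_const: "sq_norm M (\<lambda>x. c) = ennreal ((cmod c)\<^sup>2)"
  by (simp add: sq_norm_def emeasure_space_1)

lemma (in prob_space) sq_norm_unimodular:
  "(\<And>x. x \<in> space M \<Longrightarrow> cmod (f x) = 1) \<Longrightarrow> sq_norm M f = 1"
  by (simp add: sq_norm_def emeasure_space_1 cong: nn_integral_cong)

lemma borel_measurable_cnj [measurable]: "cnj \<in> borel_measurable borel"
  by (intro borel_measurable_continuous_onI continuous_intros)

text \<open>
  Multiplication by a unimodular function is an isometry of \<open>L\<^sup>2\<close>, so the twist can be undone for
  one index \<open>k\<close> at a time: \<open>h(x) e\<^sub>k(y)\<close> is approximated by approximating \<open>h \<cdot> cnj u\<^sub>k\<close> by the span of \<open>E\<close>.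
  From there, products \<open>h(x) p(y)\<close> with \<open>p\<close> in the span of the \<open>e\<^sub>k\<close> follow by linearity, then
  indicators of rectangles, then everything.
\<close>

lemma L2_total_twisted:
  assumes M: "prob_space M" and N: "prob_space N"
    and E: "L2_total M E" and e: "L2_total N (range e)"
    and u[measurable]: "\<And>k. u k \<in> borel_measurable M"
    and u_1: "\<And>k x. x \<in> space M \<Longrightarrow> cmod (u k x) = 1"
    and e_1: "\<And>k y. y \<in> space N \<Longrightarrow> cmod (e k y) = 1"
  shows "L2_total (M \<Otimes>\<^sub>M N) (twisted E u e)"
proof -
  interpret M: prob_space M by fact
  interpret N: prob_space N by fact
  interpret P: pair_prob_space M N ..
  have E_meas: "E \<subseteq> borel_measurable M" and range_e: "range e \<subseteq> borel_measurable N"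
    using E e by (simp_all add: L2_total_def)
  have e_meas[measurable]: "e k \<in> borel_measurable N" for k using range_e by auto
  let ?T = "twisted E u e"
  have T_meas: "?T \<subseteq> borel_measurable (M \<Otimes>\<^sub>M N)"
    using E_meas by (auto simp: twisted_def)
  have T_span: "(\<lambda>z. q (fst z) * u k (fst z) * e k (snd z)) \<in> lin_span ?T"
    if "q \<in> lin_span E" for q k
    using that
  proof (induction rule: lin_span.induct)
    case (step q f c)
    have "(\<lambda>z. f (fst z) * u k (fst z) * e k (snd z)) \<in> ?T"
      using step.hyps(2) by (auto simp: twisted_def)
    from lin_span.step[OF step.IH this, of c] show ?case by (simp add: algebra_simps)
  qed (simp add: lin_span.zero)
  have single: "(\<lambda>z. h (fst z) * e k (snd z)) \<in> L2_closure (M \<Otimes>\<^sub>M N) ?T"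
    if h[measurable]: "h \<in> borel_measurable M" and h_fin: "sq_norm M h < \<infinity>" for h k
  proof (rule L2_closure_closed[OF T_meas])
    fix r :: real assume "r > 0"
    (* Untwist h, approximate, and twist back; the twist does not change the error. *)
    define h' where "h' x = h x * cnj (u k x)" for x
    have [measurable]: "h' \<in> borel_measurable M" unfolding h'_def by measurable
    have "sq_norm M h' = sq_norm M h" unfolding sq_norm_def h'_def
      by (intro nn_integral_cong) (simp add: norm_mult u_1)
    then have "h' \<in> L2_closure M E" using E h_fin by (simp add: L2_total_def)
    then obtain q where q: "q \<in> lin_span E" "sq_norm M (\<lambda>x. h' x - q x) \<le> ennreal r"
      using \<open>r > 0\<close> unfolding L2_closure_def by blast
    have [measurable]: "q \<in> borel_measurable M" by (rule lin_span_measurable[OF E_meas q(1)])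
    let ?q = "\<lambda>z. q (fst z) * u k (fst z) * e k (snd z)"
    have uu: "cnj (u k x) * u k x = 1" if "x \<in> space M" for x
      using u_1[OF that, of k] by (simp add: complex_norm_square[symmetric] mult.commute)
    have "sq_norm (M \<Otimes>\<^sub>M N) (\<lambda>z. h (fst z) * e k (snd z) - ?q z) =
        sq_norm (M \<Otimes>\<^sub>M N) (\<lambda>z. (h' (fst z) - q (fst z)) * u k (fst z) * e k (snd z))"
    proof (intro sq_norm_cong_AE AE_I2)
      fix z assume "z \<in> space (M \<Otimes>\<^sub>M N)"
      then have "fst z \<in> space M" by (auto simp: space_pair_measure)
      then have "h' (fst z) * u k (fst z) = h (fst z)" by (simp add: h'_def mult.assoc uu)
      then show "h (fst z) * e k (snd z) - ?q z =
          (h' (fst z) - q (fst z)) * u k (fst z) * e k (snd z)"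
        by (simp add: algebra_simps)
    qed
    also have "\<dots> = sq_norm M (\<lambda>x. (h' x - q x) * u k x) * sq_norm N (e k)"
      by (rule N.sq_norm_tensor) measurable
    also have "\<dots> = sq_norm M (\<lambda>x. h' x - q x)"
      by (subst N.sq_norm_unimodular)
        (auto simp: e_1 sq_norm_def norm_mult u_1 intro!: nn_integral_cong)
    finally show "\<exists>g\<in>L2_closure (M \<Otimes>\<^sub>M N) ?T.
        sq_norm (M \<Otimes>\<^sub>M N) (\<lambda>z. h (fst z) * e k (snd z) - g z) \<le> ennreal r"
      using q(2) lin_span_in_closure[OF T_meas T_span[OF q(1)]] by (intro bexI[of _ ?q]) auto
  qed measurable
  have prod_span: "(\<lambda>z. h (fst z) * p (snd z)) \<in> L2_closure (M \<Otimes>\<^sub>M N) ?T"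
    if h: "h \<in> borel_measurable M" "sq_norm M h < \<infinity>" and p: "p \<in> lin_span (range e)" for h p
    using p
  proof (induction rule: lin_span.induct)
    case zero
    show ?case using lin_span_in_closure[OF T_meas lin_span.zero] by simp
  next
    case (step p f c)
    then obtain k where "f = e k" by auto
    with L2_closure_add[OF T_meas step.IH L2_closure_scale[OF T_meas single[OF h, of k], of c]]
    show ?case by (simp add: algebra_simps)
  qed
  have rect: "indicator (A \<times> B) \<in> L2_closure (M \<Otimes>\<^sub>M N) ?T"
    if [measurable]: "A \<in> sets M" "B \<in> sets N" for A B
  proof (rule L2_closure_closed[OF T_meas])
    fix r :: real assume "r > 0"
    have le1: "sq_norm M (indicator A) \<le> 1" "sq_norm N (indicator B) \<le> 1"
    proof -
      have "sq_norm M (indicator A) \<le> sq_norm M (\<lambda>x. 1)" "sq_norm N (indicator B) \<le> sq_norm N (\<lambda>x. 1)"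
        unfolding sq_norm_def by (intro nn_integral_mono, simp split: split_indicator)+
      then show "sq_norm M (indicator A) \<le> 1" "sq_norm N (indicator B) \<le> 1"
        by (simp_all add: M.sq_norm_const N.sq_norm_const)
    qed
    have fin: "sq_norm M (indicator A) < \<infinity>" "sq_norm N (indicator B) < \<infinity>"
      using le1 by (auto intro: le_less_trans[of _ 1])
    then have "indicator B \<in> L2_closure N (range e)"
      using e by (simp add: L2_total_def)
    then obtain p where p: "p \<in> lin_span (range e)"
      "sq_norm N (\<lambda>y. indicator B y - p y) \<le> ennreal r"
      using \<open>r > 0\<close> unfolding L2_closure_def by blast
    have [measurable]: "p \<in> borel_measurable N" by (rule lin_span_measurable[OF range_e p(1)])
    have "sq_norm (M \<Otimes>\<^sub>M N) (\<lambda>z. indicator (A \<times> B) z - indicator A (fst z) * p (snd z)) =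
        sq_norm (M \<Otimes>\<^sub>M N) (\<lambda>z. indicator A (fst z) * (indicator B (snd z) - p (snd z)))"
      by (intro sq_norm_cong_AE AE_I2) (auto split: split_indicator)
    also have "\<dots> = sq_norm M (indicator A) * sq_norm N (\<lambda>y. indicator B y - p y)"
      by (rule N.sq_norm_tensor) measurable
    also have "\<dots> \<le> 1 * ennreal r" by (intro mult_mono le1 p) auto
    finally show "\<exists>g\<in>L2_closure (M \<Otimes>\<^sub>M N) ?T.
        sq_norm (M \<Otimes>\<^sub>M N) (\<lambda>z. indicator (A \<times> B) z - g z) \<le> ennreal r"
      using prod_span[OF _ fin(1) p(1)]
      by (intro bexI[of _ "\<lambda>z. indicator A (fst z) * p (snd z)"]) auto
  qed measurable
  have ind: "indicator A \<in> L2_closure (M \<Otimes>\<^sub>M N) ?T" if "A \<in> sets (M \<Otimes>\<^sub>M N)" for A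
  proof (rule L2_closure_indicators[OF _ T_meas _ Int_stable_pair_measure_generator _ _ _ that])
    show "finite_measure (M \<Otimes>\<^sub>M N)"
      by (intro prob_space.axioms(1) prob_space_pair M N)
    show "sets (M \<Otimes>\<^sub>M N) = sigma_sets (space (M \<Otimes>\<^sub>M N)) {a \<times> b |a b. a \<in> sets M \<and> b \<in> sets N}"
      by (simp add: sets_pair_measure space_pair_measure)
    show "{a \<times> b |a b. a \<in> sets M \<and> b \<in> sets N} \<subseteq> Pow (space (M \<Otimes>\<^sub>M N))"
      by (auto simp: space_pair_measure dest: sets.sets_into_space)
    show "(\<lambda>x. 1) \<in> L2_closure (M \<Otimes>\<^sub>M N) ?T"
      by (rule L2_closure_cong_AE[OF rect[OF sets.top sets.top]])
        (auto simp: space_pair_measure)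
  qed (use rect in auto)
  show ?thesis
    using T_meas L2_closure_eq_L2[OF T_meas ind] by (simp add: L2_total_def)
qed

text \<open>
  For passing between a pair product and a product over an index set with one more element:
  equality of all nonnegative integrals after composing with \<open>T\<close> carries approximations
  across, without identifying \<open>M\<close> as an image measure.
\<close>

lemma L2_total_transfer:
  assumes total: "L2_total Q {\<lambda>z. g (T z) | g. g \<in> E}"
    and T: "T \<in> measurable Q M"
    and nn: "\<And>f. f \<in> borel_measurable M \<Longrightarrow> (\<integral>\<^sup>+x. f x \<partial>M) = (\<integral>\<^sup>+z. f (T z) \<partial>Q)"
    and E: "E \<subseteq> borel_measurable M"
  shows "L2_total M E"
proof -
  note T[measurable]
  have sq_norm_T: "sq_norm M f = sq_norm Q (\<lambda>z. f (T z))" if [measurable]: "f \<in> borel_measurable M" for f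
    unfolding sq_norm_def by (rule nn) measurable
  have lift: "\<exists>p\<in>lin_span E. q = (\<lambda>z. p (T z))"
    if "q \<in> lin_span {\<lambda>z. g (T z) | g. g \<in> E}" for q
    using that
  proof (induction rule: lin_span.induct)
    case zero
    show ?case by (intro bexI[OF _ lin_span.zero]) simp
  next
    case (step q f c)
    then obtain p g where "p \<in> lin_span E" "q = (\<lambda>z. p (T z))" "g \<in> E" "f = (\<lambda>z. g (T z))"
      by blast
    then show ?case by (intro bexI[of _ "\<lambda>x. p x + c * g x"]) (auto intro: lin_span.step)
  qed
  have "f \<in> L2_closure M E" if f[measurable]: "f \<in> borel_measurable M" and "sq_norm M f < \<infinity>" for f
  proof -
    have "(\<lambda>z. f (T z)) \<in> L2_closure Q {\<lambda>z. g (T z) | g. g \<in> E}"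
      using total that sq_norm_T[OF f] by (simp add: L2_total_def)
    then have "\<exists>p\<in>lin_span E. sq_norm Q (\<lambda>z. f (T z) - p (T z)) \<le> ennreal r" if "r > 0" for r
      using that lift unfolding L2_closure_def by blast
    moreover have "sq_norm Q (\<lambda>z. f (T z) - p (T z)) = sq_norm M (\<lambda>x. f x - p x)"
      if "p \<in> lin_span E" for p
      using lin_span_measurable[OF E that] by (subst sq_norm_T) auto
    ultimately show ?thesis using f unfolding L2_closure_def by force
  qed
  with E show ?thesis by (simp add: L2_total_def)
qed

text \<open>
  Elements of \<open>L\<^sup>2(M)\<close> are only relevant on \<open>space M\<close>, whereas the functions in a system are defined
  on the whole type.
\<close>

lemma L2_total_cong:
  assumes E: "L2_total M E" and E': "E' \<subseteq> borel_measurable M"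
    and eq: "\<And>g. g \<in> E \<Longrightarrow> \<exists>g'\<in>E'. \<forall>x\<in>space M. g x = g' x"
  shows "L2_total M E'"
proof -
  have EM: "E \<subseteq> borel_measurable M" using E by (simp add: L2_total_def)
  have "\<exists>q\<in>lin_span E'. \<forall>x\<in>space M. p x = q x" if "p \<in> lin_span E" for p
    using that
  proof (induction rule: lin_span.induct)
    case zero
    show ?case by (intro bexI[OF _ lin_span.zero]) simp
  next
    case (step p f c)
    then obtain q where q: "q \<in> lin_span E'" "\<forall>x\<in>space M. p x = q x" by blast
    from eq[OF step.hyps(2)] obtain g where g: "g \<in> E'" "\<forall>x\<in>space M. f x = g x" by blast
    show ?case using q g lin_span.step[OF q(1) g(1), of c]
      by (intro bexI[of _ "\<lambda>x. q x + c * g x"]) auto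
  qed
  note restrict_eq = this
  have "L2_closure M E \<subseteq> L2_closure M E'"
  proof
    fix f assume f: "f \<in> L2_closure M E"
    have "\<exists>q\<in>lin_span E'. sq_norm M (\<lambda>x. f x - q x) \<le> ennreal r" if "r > 0" for r
    proof -
      from f that obtain p where p: "p \<in> lin_span E" "sq_norm M (\<lambda>x. f x - p x) \<le> ennreal r"
        unfolding L2_closure_def by blast
      from restrict_eq[OF p(1)] obtain q where q: "q \<in> lin_span E'" "\<forall>x\<in>space M. p x = q x"
        by blast
      have "sq_norm M (\<lambda>x. f x - q x) = sq_norm M (\<lambda>x. f x - p x)"
        using q(2) by (intro sq_norm_cong_AE AE_I2) simp
      then show ?thesis using p(2) by (intro bexI[OF _ q(1)]) simp
    qed
    then show "f \<in> L2_closure M E'" using f by (simp add: L2_closure_def)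
  qed
  with E E' show ?thesis by (auto simp: L2_total_def)
qed

lemma L2_total_PiM_insert:
  assumes N: "prob_space N" and I: "finite I" "i \<notin> I"
    and E: "L2_total (\<Pi>\<^sub>M j\<in>I. N) E" and e: "L2_total N (range e)"
    and u[measurable]: "\<And>k. u k \<in> borel_measurable (\<Pi>\<^sub>M j\<in>I. N)"
    and u_1: "\<And>k x. x \<in> space (\<Pi>\<^sub>M j\<in>I. N) \<Longrightarrow> cmod (u k x) = 1"
    and e_1: "\<And>k y. y \<in> space N \<Longrightarrow> cmod (e k y) = 1"
  shows "L2_total (\<Pi>\<^sub>M j\<in>insert i I. N)
    {\<lambda>x. g (restrict x I) * u k (restrict x I) * e k (x i) | k g. g \<in> E}" (is "L2_total ?P ?E")
proof -
  interpret N: prob_space N by fact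
  interpret product_sigma_finite "\<lambda>_. N" ..
  let ?M = "\<Pi>\<^sub>M j\<in>I. N"
  have M: "prob_space ?M" by (rule prob_space_PiM) (rule N)
  have E_meas: "E \<subseteq> borel_measurable ?M" and range_e: "range e \<subseteq> borel_measurable N"
    using E e by (simp_all add: L2_total_def)
  have e_meas[measurable]: "e k \<in> borel_measurable N" for k using range_e by auto
  have [measurable]: "(\<lambda>x. restrict x I) \<in> measurable ?P ?M"
    by (rule measurable_restrict_subset) auto
  have E'_meas: "?E \<subseteq> borel_measurable ?P"
    using E_meas by auto
  let ?T = "\<lambda>(x, y). x(i := y)"
  have T[measurable]: "?T \<in> measurable (?M \<Otimes>\<^sub>M N) ?P"
    by (rule measurable_add_dim)
  show ?thesis
  proof (rule L2_total_transfer[OF _ T _ E'_meas])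
    fix f :: "_ \<Rightarrow> ennreal" assume [measurable]: "f \<in> borel_measurable ?P"
    have "(\<integral>\<^sup>+x. f x \<partial>?P) = (\<integral>\<^sup>+x. \<integral>\<^sup>+y. f (?T (x, y)) \<partial>N \<partial>?M)"
      using I by (simp add: product_nn_integral_insert)
    also have "\<dots> = (\<integral>\<^sup>+z. f (?T z) \<partial>(?M \<Otimes>\<^sub>M N))"
      by (rule N.nn_integral_fst) measurable
    finally show "(\<integral>\<^sup>+x. f x \<partial>?P) = (\<integral>\<^sup>+z. f (?T z) \<partial>(?M \<Otimes>\<^sub>M N))" .
  next
    show "L2_total (?M \<Otimes>\<^sub>M N) {\<lambda>z. g (?T z) | g. g \<in> ?E}"
    proof (rule L2_total_cong[OF L2_total_twisted[OF M N E e u u_1 e_1]])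
      show "{\<lambda>z. g (?T z) | g. g \<in> ?E} \<subseteq> borel_measurable (?M \<Otimes>\<^sub>M N)"
      proof safe
        fix k g assume "g \<in> E"
        then have "(\<lambda>x. g (restrict x I) * u k (restrict x I) * e k (x i)) \<in> borel_measurable ?P"
          by (intro subsetD[OF E'_meas]) blast
        from measurable_compose[OF T this]
        show "(\<lambda>z. g (restrict (?T z) I) * u k (restrict (?T z) I) * e k (?T z i))
            \<in> borel_measurable (?M \<Otimes>\<^sub>M N)" .
      qed
      fix f assume "f \<in> twisted E u e"
      then obtain k g where g: "g \<in> E" "f = (\<lambda>z. g (fst z) * u k (fst z) * e k (snd z))"
        by (auto simp: twisted_def)
      let ?g = "\<lambda>x. g (restrict x I) * u k (restrict x I) * e k (x i)"
      have "restrict (x(i := y)) I = x" if "x \<in> space ?M" for x y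
        using that I by (auto simp: space_PiM PiE_def extensional_def fun_eq_iff)
      then have eq: "\<forall>z\<in>space (?M \<Otimes>\<^sub>M N). f z = ?g (?T z)"
        by (auto simp: space_pair_measure g)
      have mem: "?g \<in> ?E" using g by blast
      have "(\<lambda>z. ?g (?T z)) \<in> {\<lambda>z. g (?T z) | g. g \<in> ?E}"
        by (rule CollectI, rule exI[of _ ?g], rule conjI[OF refl mem])
      with eq show "\<exists>g'\<in>{\<lambda>z. g (?T z) | g. g \<in> ?E}. \<forall>z\<in>space (?M \<Otimes>\<^sub>M N). f z = g' z"
        by (rule bexI)
    qed
  qed
qed

section \<open>Exponentials on the unit interval\<close>

definition unit_exp :: "real \<Rightarrow> complex" where
  "unit_exp t = exp (2 * of_real pi * \<i> * of_real t)"

definition unit_interval :: "real measure" where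
  "unit_interval = restrict_space lborel {0..1}"

lemma unit_exp_add: "unit_exp (s + t) = unit_exp s * unit_exp t"
  by (simp add: unit_exp_def ring_distribs exp_add)

lemma unit_exp_0 [simp]: "unit_exp 0 = 1"
  by (simp add: unit_exp_def)

lemma unit_exp_cis: "unit_exp t = cis (2 * pi * t)"
  by (simp add: unit_exp_def cis_conv_exp mult_ac)

lemma norm_unit_exp [simp]: "cmod (unit_exp t) = 1"
  by (simp add: unit_exp_cis)

lemma cnj_unit_exp: "cnj (unit_exp t) = unit_exp (- t)"
  by (simp add: unit_exp_cis cis_cnj)

lemma continuous_unit_exp: "continuous_on A unit_exp"
  unfolding unit_exp_def by (intro continuous_intros)

lemma unit_exp_measurable [measurable]: "unit_exp \<in> borel_measurable borel"
  by (rule borel_measurable_continuous_onI[OF continuous_unit_exp])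

lemma unit_exp_eq_1_iff: "unit_exp t = 1 \<longleftrightarrow> t \<in> \<int>"
proof
  assume "unit_exp t = 1"
  then obtain n :: int where "t = of_int n"
    by (auto simp: unit_exp_def exp_eq_1)
  then show "t \<in> \<int>" by simp
next
  assume "t \<in> \<int>"
  then show "unit_exp t = 1" by (auto elim!: Ints_cases simp: unit_exp_def exp_eq_1)
qed

lemma space_unit_interval [simp]: "space unit_interval = {0..1}"
  by (simp add: unit_interval_def space_restrict_space)

lemma prob_space_unit_interval: "prob_space unit_interval"
  by (rule prob_spaceI) (simp add: unit_interval_def space_restrict_space emeasure_restrict_space)

lemma id_unit_interval [measurable]: "(\<lambda>t. t) \<in> measurable unit_interval borel"
  unfolding unit_interval_def by (intro measurable_restrict_space1) simp

lemma unit_exp_integral: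
  "(LINT t|unit_interval. unit_exp (of_int k * t)) = (if k = 0 then 1 else 0)"
proof -
  interpret prob_space unit_interval by (rule prob_space_unit_interval)
  have eq: "(LINT t|unit_interval. unit_exp (of_int k * t)) =
      (LBINT t:{0..1}. unit_exp (of_int k * t))"
    unfolding unit_interval_def set_lebesgue_integral_def
    by (subst integral_restrict_space) auto
  show ?thesis
  proof (cases "k = 0")
    case True
    then show ?thesis using prob_space by simp
  next
    case False
    define a :: complex where "a = 2 * of_real pi * \<i> * of_int k"
    have a: "a \<noteq> 0" using False by (simp add: a_def)
    have "(LBINT t:{0..1}. unit_exp (of_int k * t)) = exp (a * of_real 1) / a - exp (a * of_real 0) / a"
      unfolding set_lebesgue_integral_def
    proof (rule integral_FTC_atLeastAtMost)
      show "((\<lambda>t. exp (a * of_real t) / a) has_vector_derivative unit_exp (of_int k * t))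
          (at t within {0..1})" for t
      proof -
        have "((\<lambda>z. exp (a * z) / a) has_field_derivative unit_exp (of_int k * t)) (at (of_real t))"
          using a by (auto intro!: derivative_eq_intros simp: unit_exp_def a_def mult_ac)
        then show ?thesis by (rule has_vector_derivative_real_field)
      qed
      show "continuous_on {0..1} (\<lambda>t. unit_exp (of_int k * t))"
        unfolding unit_exp_def by (intro continuous_intros)
    qed simp
    also have "exp (a * of_real 1) = unit_exp (of_int k)" by (simp add: a_def unit_exp_def)
    also have "\<dots> = 1" by (simp add: unit_exp_eq_1_iff)
    finally show ?thesis using False eq by simp
  qed
qed

section \<open>Totality of the Fourier modes on the unit interval\<close>

definition fourier_mode :: "int \<Rightarrow> real \<Rightarrow> complex" where
  "fourier_mode k t = unit_exp (of_int k * t)"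

abbreviation trig_polys :: "(real \<Rightarrow> complex) set" where
  "trig_polys \<equiv> lin_span (range fourier_mode)"

lemma fourier_mode_mult: "fourier_mode k t * fourier_mode m t = fourier_mode (k + m) t"
  by (simp add: fourier_mode_def unit_exp_add ring_distribs)

lemma fourier_mode_measurable: "range fourier_mode \<subseteq> borel_measurable unit_interval"
  unfolding fourier_mode_def by auto

lemma trig_polys_mult:
  assumes g: "g \<in> trig_polys" and h: "h \<in> trig_polys"
  shows "(\<lambda>t. g t * h t) \<in> trig_polys"
proof -
  have mode: "(\<lambda>t. g t * fourier_mode m t) \<in> trig_polys" for m
    using g
  proof (induction rule: lin_span.induct)
    case (step g f c)
    then obtain k where "f = fourier_mode k" by auto
    with lin_span.step[OF step.IH, of "fourier_mode (k + m)" c] show ?case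
      by (simp add: algebra_simps fourier_mode_mult[symmetric])
  qed (simp add: lin_span.zero)
  show ?thesis
    using h
  proof (induction rule: lin_span.induct)
    case (step h f c)
    then obtain k where "f = fourier_mode k" by auto
    with lin_span_add[OF step.IH lin_span_scale[OF mode[of k], of c]] show ?case
      by (simp add: algebra_simps)
  qed (simp add: lin_span.zero)
qed

text \<open>
  On the circle, real and imaginary part are combinations of \<open>z\<close> and \<open>z\<^sup>-\<^sup>1\<close>, so the polynomial
  functions provided by the Stone--Weierstrass theorem become trigonometric polynomials.
\<close>

lemma real_polynomial_trig_poly:
  "real_polynomial_function p \<Longrightarrow> (\<lambda>t. of_real (p (unit_exp t))) \<in> trig_polys"
proof (induction rule: real_polynomial_function.induct)
  case (linear f)
  interpret bounded_linear f by fact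
  have f: "f z = Re z * f 1 + Im z * f \<i>" for z
  proof -
    have "f z = f (Re z *\<^sub>R 1 + Im z *\<^sub>R \<i>)"
      by (rule arg_cong[of _ _ f]) (simp add: complex_eq_iff)
    then show ?thesis by (simp add: add scaleR)
  qed
  (* Re z * f 1 + Im z * f \<i> rewritten in terms of z and cnj z. *)
  define a b where "a = (of_real (f 1) - \<i> * of_real (f \<i>)) / 2"
    and "b = (of_real (f 1) + \<i> * of_real (f \<i>)) / 2"
  have "complex_of_real (f (unit_exp t)) = a * fourier_mode 1 t + b * fourier_mode (- 1) t" for t
    by (subst f) (simp add: fourier_mode_def a_def b_def complex_eq_iff cnj_unit_exp[symmetric]
        field_simps)
  then show ?case
    by (simp only:) (intro lin_span_add lin_span_scale lin_span_base rangeI)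
next
  case (const c)
  have "(\<lambda>t. of_real c * fourier_mode 0 t) \<in> trig_polys"
    by (intro lin_span_scale lin_span_base rangeI)
  moreover have "fourier_mode 0 t = 1" for t by (simp add: fourier_mode_def)
  ultimately show ?case by simp
qed (simp_all add: lin_span_add trig_polys_mult)

lemma continuous_circle_in_closure:
  fixes g :: "complex \<Rightarrow> real"
  assumes g: "continuous_on UNIV g"
  shows "(\<lambda>t. of_real (g (unit_exp t))) \<in> L2_closure unit_interval (range fourier_mode)"
proof -
  interpret prob_space unit_interval by (rule prob_space_unit_interval)
  have [measurable]: "g \<in> borel_measurable borel" using g by (rule borel_measurable_continuous_onI)
  have "\<exists>p\<in>trig_polys. sq_norm unit_interval (\<lambda>t. of_real (g (unit_exp t)) - p t) \<le> ennreal r"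
    if r: "r > 0" for r
  proof -
    obtain p where p: "real_polynomial_function p"
      "\<And>z. z \<in> sphere 0 1 \<Longrightarrow> \<bar>g z - p z\<bar> < sqrt r"
    proof (rule Stone_Weierstrass_real_polynomial_function[of "sphere 0 1" g "sqrt r"])
      show "continuous_on (sphere 0 1) g" by (rule continuous_on_subset[OF g]) simp
    qed (use r in auto)
    have "sq_norm unit_interval (\<lambda>t. of_real (g (unit_exp t)) - of_real (p (unit_exp t))) \<le>
        sq_norm unit_interval (\<lambda>t. of_real (sqrt r))"
      unfolding sq_norm_def
    proof (intro nn_integral_mono ennreal_leI power_mono)
      fix t
      show "cmod (of_real (g (unit_exp t)) - of_real (p (unit_exp t))) \<le> cmod (of_real (sqrt r))"
        using p(2)[of "unit_exp t"] that by (simp flip: of_real_diff)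
    qed simp
    also have "\<dots> = ennreal r" using that by (simp add: sq_norm_const)
    finally show ?thesis by (rule bexI[OF _ real_polynomial_trig_poly[OF p(1)]])
  qed
  then show ?thesis by (simp add: L2_closure_def)
qed

text \<open>
  An open set \<open>U\<close> away from both endpoints is the preimage of the complement of a compact subset \<open>K\<close>
  of the circle, since gluing \<open>0\<close> to \<open>1\<close> happens inside the complement.  The continuous functions
  \<open>min 1 (n \<cdot> infdist z K)\<close> on the plane then increase to the indicator.
\<close>

lemma indicator_open_in_closure:
  assumes U: "open U" "U \<subseteq> {0<..<1}"
  shows "indicator U \<in> L2_closure unit_interval (range fourier_mode)"
proof -
  interpret prob_space unit_interval by (rule prob_space_unit_interval)
  define K where "K = unit_exp ` ({0..1} - U)"
  have "compact ({0..1} - U)"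
    using U(1) by (intro compact_diff) auto
  then have "closed K" unfolding K_def
    by (intro compact_imp_closed compact_continuous_image continuous_unit_exp)
  have "0 \<notin> U" using U(2) by auto
  then have "K \<noteq> {}" by (force simp: K_def)
  (* Points of [0,1] with equal image differ by an integer, so only 0 and 1 are identified. *)
  have inK: "unit_exp t \<in> K \<longleftrightarrow> t \<notin> U" if t: "t \<in> {0..1}" for t
  proof
    assume "unit_exp t \<in> K"
    then obtain s where s: "s \<in> {0..1}" "s \<notin> U" "unit_exp t = unit_exp s" by (auto simp: K_def)
    have "unit_exp (t - s) * unit_exp s = 1 * unit_exp s"
      using s(3) by (simp add: unit_exp_add[symmetric])
    then have "unit_exp (t - s) = 1"
      by (metis mult_cancel_right norm_unit_exp norm_zero zero_neq_one)
    then obtain n :: int where n: "t - s = of_int n" by (auto simp: unit_exp_eq_1_iff elim: Ints_cases)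
    show "t \<notin> U"
    proof
      assume "t \<in> U"
      then have "0 < t" "t < 1" using U(2) by auto
      with n s(1) have "- 1 < real_of_int n" "real_of_int n < 1" by auto
      then have "n = 0" by linarith
      with n s(2) \<open>t \<in> U\<close> show False by simp
    qed
  qed (use t in \<open>auto simp: K_def\<close>)
  let ?u = "\<lambda>n t. complex_of_real (min 1 (real n * infdist (unit_exp t) K))"
  show ?thesis
  proof (rule L2_closure_dominated[where u = ?u and w = "\<lambda>_. 1"])
    show "?u n \<in> L2_closure unit_interval (range fourier_mode)" for n
      by (rule continuous_circle_in_closure) (intro continuous_intros)
    have "U \<in> sets borel" using U by simp
    then have "indicator U \<in> borel_measurable borel" by simp
    then show "indicator U \<in> borel_measurable unit_interval"
      using measurable_compose[OF id_unit_interval] by blast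
    fix t assume "t \<in> space unit_interval"
    then have t: "t \<in> {0..1}" by simp
    show "cmod (indicator U t - ?u n t) \<le> 1" for n
    proof -
      define v where "v = min 1 (real n * infdist (unit_exp t) K)"
      have "0 \<le> v" "v \<le> 1" by (auto simp: v_def infdist_nonneg)
      moreover have "indicator U t - complex_of_real v = of_real (indicator U t - v)"
        by (simp split: split_indicator)
      ultimately show ?thesis unfolding v_def[symmetric]
        by (simp only: norm_of_real) (auto split: split_indicator)
    qed
    show "(\<lambda>n. ?u n t) \<longlonglongrightarrow> indicator U t"
    proof (cases "t \<in> U")
      case False
      then have "infdist (unit_exp t) K = 0" using inK[OF t] by simp
      with False show ?thesis by simp
    next
      case True
      then have "unit_exp t \<notin> K" using inK[OF t] by simp
      then have pos: "infdist (unit_exp t) K > 0"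
        using in_closed_iff_infdist_zero[OF \<open>closed K\<close> \<open>K \<noteq> {}\<close>] infdist_nonneg[of "unit_exp t" K]
        by (simp add: less_le)
      then obtain n0 :: nat where n0: "1 < real n0 * infdist (unit_exp t) K"
        using reals_Archimedean3 by blast
      have "?u n t = 1" if "n \<ge> n0" for n
      proof -
        have "real n0 * infdist (unit_exp t) K \<le> real n * infdist (unit_exp t) K"
          using that pos by (intro mult_right_mono) auto
        with n0 show ?thesis by simp
      qed
      then have "eventually (\<lambda>n. ?u n t = 1) sequentially"
        by (auto simp: eventually_sequentially)
      then show ?thesis using True by (simp add: tendsto_eventually)
    qed
  qed (use fourier_mode_measurable emeasure_space_1 in auto)
qed

text \<open>
  Relatively open sets generate the Borel sets of \<open>[0,1]\<close>, and each differs from an open set away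
  from the endpoints by a null set.
\<close>

theorem L2_total_fourier: "L2_total unit_interval (range fourier_mode)"
proof -
  interpret prob_space unit_interval by (rule prob_space_unit_interval)
  let ?L = "L2_closure unit_interval (range fourier_mode)"
  let ?G = "(\<inter>) {0..1::real} ` {S. open S}"
  have sets: "sets unit_interval = sigma_sets (space unit_interval) ?G"
  proof -
    have borel: "sets (borel :: real measure) = sigma_sets UNIV {S. open S}"
      by (simp add: borel_def)
    have "{0..1::real} \<in> sigma_sets UNIV {S. open S}"
      unfolding borel[symmetric] by simp
    from sigma_sets_Int[OF this] show ?thesis
      by (simp add: unit_interval_def space_restrict_space sets_restrict_space borel)
  qed
  have "indicator A \<in> ?L" if "A \<in> sets unit_interval" for A
  proof (rule L2_closure_indicators[OF _ fourier_mode_measurable sets _ _ _ _ that])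
    show "finite_measure unit_interval" by (rule finite_measure_axioms)
    show "Int_stable ?G"
    proof (rule Int_stableI)
      fix a b assume "a \<in> ?G" "b \<in> ?G"
      then obtain S T where "open S" "open T" "a = {0..1} \<inter> S" "b = {0..1} \<inter> T" by auto
      then show "a \<inter> b \<in> ?G" by (intro image_eqI[of _ _ "S \<inter> T"]) auto
    qed
    show "?G \<subseteq> Pow (space unit_interval)" by auto
    have "fourier_mode 0 = (\<lambda>x. 1)" by (simp add: fourier_mode_def fun_eq_iff)
    then show "(\<lambda>x. 1) \<in> ?L"
      using lin_span_in_closure[OF fourier_mode_measurable lin_span_base[OF rangeI[of _ 0]]] by simp
    fix B assume "B \<in> ?G"
    then obtain S where S: "open S" "B = {0..1} \<inter> S" by auto
    show "indicator B \<in> ?L"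
    proof (rule L2_closure_cong_AE[OF indicator_open_in_closure[of "S \<inter> {0<..<1}"]])
      show "indicator B \<in> borel_measurable unit_interval"
        using \<open>B \<in> ?G\<close> sets by (intro borel_measurable_indicator) auto
      have "AE x in lborel. x \<noteq> (0::real)" "AE x in lborel. x \<noteq> (1::real)"
        by (rule AE_lborel_singleton)+
      then show "AE x in unit_interval. indicator (S \<inter> {0<..<1}) x = (indicator B x :: complex)"
        unfolding unit_interval_def
        by (subst AE_restrict_space_iff) (auto simp: S(2) split: split_indicator elim!: eventually_elim2)
    qed (use S in auto)
  qed
  then show ?thesis
    using fourier_mode_measurable L2_closure_eq_L2[OF fourier_mode_measurable]
    by (simp add: L2_total_def)
qed

section \<open>Measurability of continuously differentiable functions on the cube\<close>

text \<open>
  In the full function space, the cube is a product in which the coordinates off \<open>I\<close> range over a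
  single point, so Tychonoff's theorem applies.
\<close>

lemma compact_unit_cube: "compact (unit_cube I)"
proof -
  have eq: "unit_cube I = (\<Pi>\<^sub>E i\<in>UNIV. if i \<in> I then {0..1} else {undefined})"
    by (auto simp: unit_cube_def PiE_def extensional_def Pi_def split: if_splits)
  have "compactin (product_topology (\<lambda>_. euclidean) UNIV)
      (\<Pi>\<^sub>E i\<in>UNIV. if i \<in> I then {0..1::real} else {undefined})"
    by (subst compactin_PiE) auto
  then show ?thesis by (simp only: eq euclidean_product_topology compactin_euclidean_iff)
qed

text \<open>
  The partial derivatives are bounded by compactness, so the mean value theorem applies along
  each axis.  Going from \<open>x\<close> to \<open>y\<close> by changing one coordinate at a time stays in the cube and
  adds up these estimates.
\<close>

lemma C1_on_cube_Lipschitz: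
  assumes I: "finite I" and C1: "C1_on_cube I f"
  obtains B where "\<And>x y. x \<in> unit_cube I \<Longrightarrow> y \<in> unit_cube I \<Longrightarrow>
    \<bar>f y - f x\<bar> \<le> B * (\<Sum>i\<in>I. \<bar>y i - x i\<bar>)"
proof -
  from C1 obtain D where D: "\<And>i. i \<in> I \<Longrightarrow> continuous_on (unit_cube I) (D i)"
    "\<And>i x. i \<in> I \<Longrightarrow> x \<in> unit_cube I \<Longrightarrow>
      ((\<lambda>t. f (x(i := t))) has_real_derivative D i x) (at (x i) within {0..1})"
    unfolding C1_on_cube_def by blast
  have "\<exists>b. \<forall>x\<in>unit_cube I. \<bar>D i x\<bar> \<le> b" if "i \<in> I" for i
    using compact_imp_bounded[OF compact_continuous_image[OF D(1)[OF that] compact_unit_cube]]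
    by (auto simp: bounded_iff)
  then obtain b where b: "\<And>i x. i \<in> I \<Longrightarrow> x \<in> unit_cube I \<Longrightarrow> \<bar>D i x\<bar> \<le> b i" by metis
  define B where "B = (\<Sum>i\<in>I. \<bar>b i\<bar>)"
  have B: "\<bar>D i x\<bar> \<le> B" if "i \<in> I" "x \<in> unit_cube I" for i x
  proof -
    have "\<bar>D i x\<bar> \<le> \<bar>b i\<bar>" using b[OF that] by simp
    also have "\<dots> \<le> B" unfolding B_def using I that by (intro member_le_sum) auto
    finally show ?thesis .
  qed
  have upd: "x(i := s) \<in> unit_cube I" if "x \<in> unit_cube I" "i \<in> I" "s \<in> {0..1}" for x i s
    using that by (auto simp: unit_cube_def PiE_def extensional_def)
  have coord: "x i \<in> {0..1}" if "x \<in> unit_cube I" "i \<in> I" for x i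
    using that by (auto simp: unit_cube_def)
  have one: "\<bar>f (x(i := t)) - f x\<bar> \<le> B * \<bar>t - x i\<bar>"
    if x: "x \<in> unit_cube I" and i: "i \<in> I" and t: "t \<in> {0..1}" for x i t
  proof -
    have "norm (f (x(i := t)) - f (x(i := x i))) \<le> B * norm (t - x i)"
    proof (rule field_differentiable_bound[of "{0..1}" _ "\<lambda>s. D i (x(i := s))"])
      fix s :: real assume s: "s \<in> {0..1}"
      show "((\<lambda>s. f (x(i := s))) has_real_derivative D i (x(i := s))) (at s within {0..1})"
        using D(2)[OF i upd[OF x i s]] by simp
      show "norm (D i (x(i := s))) \<le> B" using B[OF i upd[OF x i s]] by simp
    qed (use t coord[OF x i] in auto)
    then show ?thesis by simp
  qed
  have many: "(\<lambda>j. if j \<in> J then y j else x j) \<in> unit_cube I \<and>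
      \<bar>f (\<lambda>j. if j \<in> J then y j else x j) - f x\<bar> \<le> B * (\<Sum>i\<in>J. \<bar>y i - x i\<bar>)"
    if x: "x \<in> unit_cube I" and y: "y \<in> unit_cube I" and "finite J" "J \<subseteq> I" for x y J
    using \<open>finite J\<close> \<open>J \<subseteq> I\<close>
  proof (induction J rule: finite_induct)
    case empty
    then show ?case using x by simp
  next
    case (insert i J)
    let ?z = "\<lambda>j. if j \<in> J then y j else x j"
    have z: "?z \<in> unit_cube I" "\<bar>f ?z - f x\<bar> \<le> B * (\<Sum>i\<in>J. \<bar>y i - x i\<bar>)"
      using insert by auto
    have i: "i \<in> I" using insert.prems by simp
    have eq: "(\<lambda>j. if j \<in> insert i J then y j else x j) = ?z(i := y i)" by auto
    have "\<bar>f (?z(i := y i)) - f ?z\<bar> \<le> B * \<bar>y i - x i\<bar>"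
      using one[OF z(1) i coord[OF y i]] insert.hyps by simp
    then have "\<bar>f (?z(i := y i)) - f x\<bar> \<le> B * \<bar>y i - x i\<bar> + B * (\<Sum>i\<in>J. \<bar>y i - x i\<bar>)"
      using z(2) by linarith
    then show ?case unfolding eq
      using upd[OF z(1) i coord[OF y i]] insert.hyps by (simp add: ring_distribs)
  qed
  show ?thesis
  proof
    fix x y assume xy: "x \<in> unit_cube I" "y \<in> unit_cube I"
    then have "(\<lambda>j. if j \<in> I then y j else x j) = y"
      by (auto simp: unit_cube_def PiE_def extensional_def)
    then show "\<bar>f y - f x\<bar> \<le> B * (\<Sum>i\<in>I. \<bar>y i - x i\<bar>)"
      using many[OF xy I] by simp
  qed
qed

lemma C1_on_cube_continuous:
  assumes "finite I" "C1_on_cube I f"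
  shows "continuous_on (unit_cube I) f"
proof -
  obtain B where B: "\<And>x y. x \<in> unit_cube I \<Longrightarrow> y \<in> unit_cube I \<Longrightarrow>
    \<bar>f y - f x\<bar> \<le> B * (\<Sum>i\<in>I. \<bar>y i - x i\<bar>)"
    using C1_on_cube_Lipschitz[OF assms] by blast
  show ?thesis
    unfolding continuous_on_def
  proof
    fix x assume x: "x \<in> unit_cube I"
    have coord: "((\<lambda>y. y i) \<longlongrightarrow> x i) (at x within unit_cube I)" for i
      using continuous_on_product_coordinates[of i]
      by (auto simp: continuous_on_def intro: tendsto_within_subset)
    have "((\<lambda>y. B * (\<Sum>i\<in>I. \<bar>y i - x i\<bar>)) \<longlongrightarrow> B * (\<Sum>i\<in>I. \<bar>x i - x i\<bar>)) (at x within unit_cube I)"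
      by (intro tendsto_intros coord)
    then have "((\<lambda>y. B * (\<Sum>i\<in>I. \<bar>y i - x i\<bar>)) \<longlongrightarrow> 0) (at x within unit_cube I)" by simp
    then have "((\<lambda>y. f y - f x) \<longlongrightarrow> 0) (at x within unit_cube I)"
      by (rule Lim_null_comparison[rotated]) (use B x in \<open>auto simp: eventually_at_filter\<close>)
    then show "(f \<longlongrightarrow> f x) (at x within unit_cube I)" by (simp add: LIM_zero_iff)
  qed
qed

lemma space_cube [simp]: "space (\<Pi>\<^sub>M i\<in>I. unit_interval) = unit_cube I"
  by (simp add: space_PiM unit_cube_def)

lemma cube_coordinate_measurable:
  assumes "i \<in> I"
  shows "(\<lambda>x. x i) \<in> borel_measurable (\<Pi>\<^sub>M i\<in>I. unit_interval)"
proof (rule measurable_compose[OF _ id_unit_interval])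
  show "(\<lambda>x. x i) \<in> measurable (\<Pi>\<^sub>M i\<in>I. unit_interval) unit_interval"
    by (rule measurable_component_singleton[OF assms])
qed

text \<open>
  Continuity refers to the topology of the full function space and measurability to the
  product over \<open>I\<close>.  The inclusion of the cube is measurable between the two, because its components
  are coordinates or the constant \<^const>\<open>undefined\<close>.
\<close>

lemma C1_on_cube_measurable:
  assumes "finite I" "C1_on_cube I f"
  shows "f \<in> borel_measurable (\<Pi>\<^sub>M i\<in>I. unit_interval)"
proof -
  let ?P = "\<Pi>\<^sub>M i\<in>I. unit_interval"
  have "(\<lambda>x. x) \<in> borel_measurable ?P"
  proof (rule measurable_coordinatewise_then_product)
    fix i
    show "(\<lambda>x. x i) \<in> borel_measurable ?P"
    proof (cases "i \<in> I")
      case True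
      then show ?thesis by (rule cube_coordinate_measurable)
    next
      case False
      then have "x i = undefined" if "x \<in> space ?P" for x
        using that by (auto simp: unit_cube_def)
      then show ?thesis by (subst measurable_cong[where g = "\<lambda>_. undefined"]) auto
    qed
  qed
  then have "(\<lambda>x. x) \<in> measurable ?P (restrict_space borel (unit_cube I))"
    by (rule measurable_restrict_space2[rotated]) simp
  from measurable_compose[OF this borel_measurable_continuous_on_restrict[OF C1_on_cube_continuous[OF assms]]]
  show ?thesis .
qed

section \<open>Modes of triangular shears\<close>

text \<open>
  The mode of frequency \<open>k\<close> for the part of the shear that involves the variables \<open>x\<^sub>n, \<dots>, x\<^sub>d\<close> only.
  Variable \<open>n\<close> makes induction over the number of variables possible; \<open>n = d + 1\<close> gives the
  constant \<open>1\<close> on a one-point space.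
\<close>

definition shear_mode ::
  "(nat \<Rightarrow> (nat \<Rightarrow> real) \<Rightarrow> real) \<Rightarrow> nat \<Rightarrow> nat \<Rightarrow> (nat \<Rightarrow> int) \<Rightarrow> (nat \<Rightarrow> real) \<Rightarrow> complex" where
  "shear_mode L d n k x =
    unit_exp (\<Sum>j=n..d. of_int (k j) * (x j + L j (restrict x {j+1..d})))"

abbreviation cube_measure :: "nat set \<Rightarrow> (nat \<Rightarrow> real) measure" where
  "cube_measure I \<equiv> \<Pi>\<^sub>M i\<in>I. unit_interval"

lemma prob_space_cube: "prob_space (cube_measure I)"
  by (intro prob_space_PiM prob_space_unit_interval)

lemma norm_shear_mode [simp]: "cmod (shear_mode L d n k x) = 1"
  by (simp add: shear_mode_def)

lemma shear_mode_cong: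
  "(\<And>j. j \<in> {n..d} \<Longrightarrow> k j = k' j) \<Longrightarrow> shear_mode L d n k = shear_mode L d n k'"
  by (auto simp: shear_mode_def fun_eq_iff intro!: arg_cong[of _ _ unit_exp] sum.cong)

lemma shear_mode_zero:
  "(\<And>j. j \<in> {n..d} \<Longrightarrow> k j = 0) \<Longrightarrow> shear_mode L d n k x = 1"
  by (simp add: shear_mode_def)

lemma shear_mode_mult_cnj:
  "shear_mode L d n k x * cnj (shear_mode L d n m x) = shear_mode L d n (\<lambda>j. k j - m j) x"
  by (simp add: shear_mode_def cnj_unit_exp unit_exp_add[symmetric] sum_subtractf[symmetric]
      algebra_simps)

text \<open>
  The factorization on which both inductions rest: a mode in the remaining variables, the twist,
  and a Fourier mode in \<open>x\<^sub>n\<close>.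
\<close>

lemma shear_mode_split:
  assumes "n \<le> d"
  shows "shear_mode L d n k x =
    shear_mode L d (Suc n) k (restrict x {Suc n..d}) *
    unit_exp (of_int (k n) * L n (restrict x {Suc n..d})) * fourier_mode (k n) (x n)"
proof -
  have "(\<Sum>j=Suc n..d. of_int (k j) * (x j + L j (restrict x {j+1..d}))) =
      (\<Sum>j=Suc n..d. of_int (k j) * (restrict x {Suc n..d} j +
        L j (restrict (restrict x {Suc n..d}) {j+1..d})))"
  proof (intro sum.cong refl)
    fix j assume "j \<in> {Suc n..d}"
    moreover from this have "{Suc n..d} \<inter> {j+1..d} = {j+1..d}" by auto
    ultimately show "of_int (k j) * (x j + L j (restrict x {j+1..d})) =
        of_int (k j) * (restrict x {Suc n..d} j + L j (restrict (restrict x {Suc n..d}) {j+1..d}))"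
      by (simp add: restrict_restrict)
  qed
  then show ?thesis
    using assms
    by (simp add: shear_mode_def fourier_mode_def sum.atLeast_Suc_atMost[of n d]
        unit_exp_add[symmetric] algebra_simps)
qed

context
  fixes L :: "nat \<Rightarrow> (nat \<Rightarrow> real) \<Rightarrow> real" and d :: nat
  assumes L: "\<And>j. 1 \<le> j \<Longrightarrow> j \<le> d \<Longrightarrow> L j \<in> borel_measurable (cube_measure {Suc j..d})"
begin

lemma shear_mode_measurable:
  assumes "1 \<le> n"
  shows "shear_mode L d n k \<in> borel_measurable (cube_measure {n..d})"
proof -
  have [measurable]: "(\<lambda>x. x j) \<in> borel_measurable (cube_measure {n..d})"
    if "j \<in> {n..d}" for j
    by (rule cube_coordinate_measurable[OF that])
  have [measurable]: "(\<lambda>x. L j (restrict x {j+1..d})) \<in> borel_measurable (cube_measure {n..d})"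
    if j: "j \<in> {n..d}" for j
  proof (rule measurable_compose[OF measurable_restrict_subset])
    show "{j+1..d} \<subseteq> {n..d}" using j by auto
    show "L j \<in> borel_measurable (cube_measure {j+1..d})" using L[of j] j assms by simp
  qed
  show ?thesis unfolding shear_mode_def[abs_def] by measurable
qed

text \<open>
  Fubini with the innermost integral over \<open>x\<^sub>n\<close>, which annihilates every mode with \<open>k\<^sub>n \<noteq> 0\<close>.  For
  \<open>k\<^sub>n = 0\<close> the twist is trivial.
\<close>

lemma integral_shear_mode:
  assumes "n \<le> Suc d" "1 \<le> n"
  shows "(LINT x|cube_measure {n..d}. shear_mode L d n k x) =
    (if \<forall>j\<in>{n..d}. k j = 0 then 1 else 0)"
  using assms
proof (induction n rule: inc_induct)
  case base
  interpret prob_space "cube_measure {Suc d..d}" by (rule prob_space_cube)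
  have "shear_mode L d (Suc d) k = (\<lambda>_. 1)" by (intro ext shear_mode_zero) simp
  then show ?case using prob_space by simp
next
  case (step n)
  interpret U: prob_space unit_interval by (rule prob_space_unit_interval)
  interpret product_sigma_finite "\<lambda>_::nat. unit_interval" ..
  interpret P: prob_space "cube_measure {n..d}" by (rule prob_space_cube)
  have ins: "{n..d} = insert n {Suc n..d}" using step.hyps by auto
  let ?u = "\<lambda>y. unit_exp (of_int (k n) * L n y)"
  let ?S = "shear_mode L d (Suc n) k"
  have meas: "shear_mode L d n k \<in> borel_measurable (cube_measure {n..d})"
    using step.prems by (rule shear_mode_measurable)
  have int: "integrable (cube_measure {n..d}) (shear_mode L d n k)"
    by (rule P.integrable_const_bound[of _ 1, OF _ meas]) simp
  have eq: "shear_mode L d n k (y(n := t)) = ?S y * ?u y * fourier_mode (k n) t"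
    if "y \<in> unit_cube {Suc n..d}" for y t
  proof -
    have "restrict (y(n := t)) {Suc n..d} = y"
      using that by (auto simp: unit_cube_def PiE_def extensional_def fun_eq_iff)
    then show ?thesis using step.hyps by (simp add: shear_mode_split[of n d])
  qed
  have "(LINT x|cube_measure {n..d}. shear_mode L d n k x) =
      (LINT y|cube_measure {Suc n..d}. LINT t|unit_interval. shear_mode L d n k (y(n := t)))"
    using int unfolding ins by (intro product_integral_insert) auto
  also have "\<dots> = (LINT y|cube_measure {Suc n..d}. ?S y * ?u y *
      (LINT t|unit_interval. fourier_mode (k n) t))"
    by (intro Bochner_Integration.integral_cong refl) (simp add: eq)
  also have "(LINT t|unit_interval. fourier_mode (k n) t) = (if k n = 0 then 1 else 0)"
    by (simp add: fourier_mode_def unit_exp_integral)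
  also have "(LINT y|cube_measure {Suc n..d}. ?S y * ?u y * (if k n = 0 then 1 else 0)) =
      (if k n = 0 then LINT y|cube_measure {Suc n..d}. ?S y else 0)"
    by simp
  also have "\<dots> = (if \<forall>j\<in>{n..d}. k j = 0 then 1 else 0)"
    using step.IH by (auto simp: ins)
  finally show ?case .
qed

text \<open>
  The induction starts on a one-point space, where all functions are constant.  In the step, the
  frequency \<open>k\<close> of the new variable and the frequency vector \<open>m\<close> of the others are independent, so
  each twisted product is the mode of frequency \<open>m(n := k)\<close>.
\<close>

lemma L2_total_shear_modes:
  assumes "n \<le> Suc d" "1 \<le> n"
  shows "L2_total (cube_measure {n..d}) (range (shear_mode L d n))"
  using assms
proof (induction n rule: inc_induct)
  case base
  let ?M = "cube_measure {Suc d..d}" and ?E = "range (shear_mode L d (Suc d))"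
  have E: "?E \<subseteq> borel_measurable ?M" using shear_mode_measurable[of "Suc d"] by auto
  have "f \<in> L2_closure ?M ?E" if f: "f \<in> borel_measurable ?M" for f
  proof (rule L2_closure_cong_AE[OF _ f])
    show "(\<lambda>x. f (\<lambda>_. undefined) * shear_mode L d (Suc d) (\<lambda>_. 0) x) \<in> L2_closure ?M ?E"
      by (intro lin_span_in_closure[OF E] lin_span_scale lin_span_base rangeI)
    show "AE x in ?M. f (\<lambda>_. undefined) * shear_mode L d (Suc d) (\<lambda>_. 0) x = f x"
      by (intro AE_I2) (simp add: unit_cube_def shear_mode_zero)
  qed
  with E show ?case by (simp add: L2_total_def)
next
  case (step n)
  have ins: "{n..d} = insert n {Suc n..d}" using step.hyps by auto
  let ?u = "\<lambda>k y. unit_exp (of_int k * L n y)"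
  have [measurable]: "L n \<in> borel_measurable (cube_measure {Suc n..d})"
    using step by (intro L) auto
  have "L2_total (cube_measure (insert n {Suc n..d}))
    {\<lambda>x. g (restrict x {Suc n..d}) * ?u k (restrict x {Suc n..d}) * fourier_mode k (x n) |
      k g. g \<in> range (shear_mode L d (Suc n))}"
    using step.IH
    by (intro L2_total_PiM_insert prob_space_unit_interval L2_total_fourier)
      (auto simp: fourier_mode_def)
  then show ?case unfolding ins[symmetric]
  proof (rule L2_total_cong)
    show "range (shear_mode L d n) \<subseteq> borel_measurable (cube_measure {n..d})"
      using shear_mode_measurable[of n] step.prems by auto
    fix f assume "f \<in> {\<lambda>x. g (restrict x {Suc n..d}) * ?u k (restrict x {Suc n..d}) *
        fourier_mode k (x n) | k g. g \<in> range (shear_mode L d (Suc n))}"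
    then obtain k m where f: "f = (\<lambda>x. shear_mode L d (Suc n) m (restrict x {Suc n..d}) *
        ?u k (restrict x {Suc n..d}) * fourier_mode k (x n))" by blast
    have "shear_mode L d (Suc n) (m(n := k)) = shear_mode L d (Suc n) m"
      by (rule shear_mode_cong) auto
    then have "f = shear_mode L d n (m(n := k))"
      using step.hyps by (simp add: f fun_eq_iff shear_mode_split[of n d])
    then show "\<exists>g'\<in>range (shear_mode L d n). \<forall>x\<in>space (cube_measure {n..d}). f x = g' x"
      by blast
  qed
qed

end

section \<open>Orthonormal bases of the completed measure\<close>

lemma completion_ex_borel_measurable_complex:
  fixes f :: "'a \<Rightarrow> complex"
  assumes f: "f \<in> borel_measurable (completion M)"
  shows "\<exists>g\<in>borel_measurable M. AE x in M. f x = g x"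
proof -
  have "(\<lambda>x. Re (f x)) \<in> borel_measurable (completion M)"
    "(\<lambda>x. Im (f x)) \<in> borel_measurable (completion M)"
    using f by auto
  then obtain a b where [measurable]: "a \<in> borel_measurable M" "b \<in> borel_measurable M"
    and eq: "AE x in M. Re (f x) = a x" "AE x in M. Im (f x) = b x"
    using completion_ex_borel_measurable_real by blast
  have "(\<lambda>x. Complex (a x) (b x)) \<in> borel_measurable M"
    unfolding Complex_eq by measurable
  moreover from eq have "AE x in M. f x = Complex (a x) (b x)"
    by eventually_elim (simp add: complex_eq_iff)
  ultimately show ?thesis by (intro bexI[of _ "\<lambda>x. Complex (a x) (b x)"])
qed

text \<open>
  Functions measurable for the completion agree almost everywhere with measurable ones, so \<open>L\<^sup>2\<close> of
  the completion is no larger, and totality may be checked before completing.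
\<close>

lemma L2_orthonormal_basis_completionI:
  fixes e :: "'k \<Rightarrow> 'a \<Rightarrow> complex"
  assumes M: "prob_space M" and total: "L2_total M (e ` K)"
    and e_1: "\<And>k x. k \<in> K \<Longrightarrow> x \<in> space M \<Longrightarrow> cmod (e k x) = 1"
    and orth: "\<And>k m. k \<in> K \<Longrightarrow> m \<in> K \<Longrightarrow>
      (LINT x|M. e k x * cnj (e m x)) = (if k = m then 1 else 0)"
  shows "L2_orthonormal_basis (completion M) K e"
  unfolding L2_orthonormal_basis_def L2_orthonormal_def
proof (intro conjI ballI allI impI)
  interpret prob_space M by fact
  have e[measurable]: "e k \<in> borel_measurable M" if "k \<in> K" for k
    using total that by (auto simp: L2_total_def)
  {
    fix k assume k: "k \<in> K"
    have "integrable M (\<lambda>x. (cmod (e k x))\<^sup>2)"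
      by (rule integrable_const_bound[of _ 1]) (use k e_1 in auto)
    then have "integrable (completion M) (\<lambda>x. (cmod (e k x))\<^sup>2)"
      using k by (subst integrable_completion) auto
    then show "e k \<in> L2_space (completion M)"
      using measurable_completion[OF e[OF k]] by (simp add: L2_space_def)
  next
    fix k m assume "k \<in> K" "m \<in> K"
    then show "L2_inner (completion M) (e k) (e m) = (if k = m then 1 else 0)"
      unfolding L2_inner_def by (subst integral_completion) (use orth in auto)
  next
    fix f and \<epsilon> :: real assume f: "f \<in> L2_space (completion M)" and "\<epsilon> > 0"
    have f_meas: "f \<in> borel_measurable (completion M)" using f by (simp add: L2_space_def)
    then obtain g where g: "g \<in> borel_measurable M" and fg: "AE x in M. f x = g x"
      using completion_ex_borel_measurable_complex by blast
    have "(\<integral>\<^sup>+x. ennreal ((cmod (f x))\<^sup>2) \<partial>completion M) < \<infinity>"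
      using f by (auto simp: L2_space_def integrable_iff_bounded)
    then have "sq_norm M f < \<infinity>" by (simp add: nn_integral_completion sq_norm_def)
    then have "sq_norm M g < \<infinity>" using sq_norm_cong_AE[OF fg] by simp
    then have "g \<in> L2_closure M (e ` K)" using total g by (simp add: L2_total_def)
    moreover have "0 < (\<epsilon>/2)\<^sup>2" using \<open>\<epsilon> > 0\<close> by simp
    ultimately obtain p where p: "p \<in> lin_span (e ` K)"
      "sq_norm M (\<lambda>x. g x - p x) \<le> ennreal ((\<epsilon>/2)\<^sup>2)"
      unfolding L2_closure_def by blast
    from lin_span_image[OF p(1)] obtain F c
      where F: "finite F" "F \<subseteq> K" "p = (\<lambda>x. \<Sum>k\<in>F. c k * e k x)" by blast
    have "p \<in> borel_measurable M"
      using lin_span_measurable[OF _ p(1)] total by (simp add: L2_total_def)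
    then have h_meas: "(\<lambda>x. (cmod (f x - p x))\<^sup>2) \<in> borel_measurable (completion M)"
      using measurable_completion[of p M borel] f_meas by measurable
    have "sq_norm M (\<lambda>x. f x - p x) = sq_norm M (\<lambda>x. g x - p x)"
      using fg by (intro sq_norm_cong_AE) (auto elim!: eventually_mono)
    then have le: "(\<integral>\<^sup>+x. ennreal ((cmod (f x - p x))\<^sup>2) \<partial>completion M) \<le> ennreal ((\<epsilon>/2)\<^sup>2)"
      using p(2) by (simp add: nn_integral_completion sq_norm_def)
    have "(LINT x|completion M. (cmod (f x - p x))\<^sup>2) \<le> (\<epsilon>/2)\<^sup>2"
      by (subst integral_eq_nn_integral[OF h_meas]) (use le in \<open>auto intro: enn2real_leI\<close>)
    then have "L2_norm (completion M) (\<lambda>x. f x - p x) \<le> \<epsilon>/2"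
      unfolding L2_norm_def using \<open>\<epsilon> > 0\<close> by (intro real_le_lsqrt) auto
    also have "\<dots> < \<epsilon>" using \<open>\<epsilon> > 0\<close> by simp
    finally show "\<exists>F c. finite F \<and> F \<subseteq> K \<and>
        L2_norm (completion M) (\<lambda>x. f x - (\<Sum>k\<in>F. c k * e k x)) < \<epsilon>"
      using F by blast
  }
qed

text \<open>
  Values of a frequency vector off \<open>{1..d}\<close> do not affect the mode, so extensional vectors yield
  all modes.
\<close>

lemma image_int_lattice_shear_mode:
  "shear_mode L d 1 ` int_lattice d = range (shear_mode L d 1)"
proof -
  have "shear_mode L d 1 k = shear_mode L d 1 (restrict k {1..d})" for k
    by (rule shear_mode_cong) simp
  moreover have "restrict k {1..d} \<in> int_lattice d" for k by (simp add: int_lattice_def)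
  ultimately show ?thesis by (auto simp: image_iff)
qed

section \<open>The orthonormal basis\<close>

theorem theorem6p1:
  fixes d :: nat
    and \<phi> :: "(nat \<Rightarrow> real) \<Rightarrow> nat \<Rightarrow> real"
    and l :: "nat \<Rightarrow> (nat \<Rightarrow> real) \<Rightarrow> real"
  assumes "d \<ge> 1"
    and "\<And>j. 1 \<le> j \<Longrightarrow> j < d \<Longrightarrow> C1_on_cube {j+1..d} (l j)"
    and "\<And>x j. x \<in> unit_cube {1..d} \<Longrightarrow> 1 \<le> j \<Longrightarrow> j < d \<Longrightarrow>
           \<phi> x j = x j + l j (restrict x {j+1..d})"
    and "\<And>x. x \<in> unit_cube {1..d} \<Longrightarrow> \<phi> x d = x d"
  shows "L2_orthonormal_basis (cube_lebesgue {1..d}) (int_lattice d) (E_fun d \<phi>)"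
proof -
  (* The last coordinate is fitted into the general pattern by a zero shear. *)
  define L where "L j = (if j < d then l j else (\<lambda>_. 0))" for j
  have L: "L j \<in> borel_measurable (cube_measure {Suc j..d})" if "1 \<le> j" "j \<le> d" for j
    using assms(2)[of j] C1_on_cube_measurable[of "{Suc j..d}" "l j"] that by (auto simp: L_def)
  let ?M = "cube_measure {1..d}"
  have E_eq: "E_fun d \<phi> k x = shear_mode L d 1 k x" if x: "x \<in> space ?M" for k x
  proof -
    have "\<phi> x j = x j + L j (restrict x {j+1..d})" if "j \<in> {1..d}" for j
      using that x assms(3)[of x j] assms(4)[of x] by (cases "j < d") (auto simp: L_def)
    then show ?thesis by (simp add: E_fun_def shear_mode_def unit_exp_def)
  qed
  have total: "L2_total ?M (E_fun d \<phi> ` int_lattice d)"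
  proof (rule L2_total_cong)
    show tot: "L2_total ?M (shear_mode L d 1 ` int_lattice d)"
      unfolding image_int_lattice_shear_mode by (rule L2_total_shear_modes[OF L]) auto
    have "E_fun d \<phi> k \<in> borel_measurable ?M" for k
      by (subst measurable_cong[OF E_eq]) (auto intro: shear_mode_measurable[OF L])
    then show "E_fun d \<phi> ` int_lattice d \<subseteq> borel_measurable ?M" by auto
  qed (use E_eq in force)
  have "L2_orthonormal_basis (completion ?M) (int_lattice d) (E_fun d \<phi>)"
  proof (rule L2_orthonormal_basis_completionI[OF prob_space_cube total])
    fix k m assume km: "k \<in> int_lattice d" "m \<in> int_lattice d"
    have "(LINT x|?M. E_fun d \<phi> k x * cnj (E_fun d \<phi> m x)) =
        (LINT x|?M. shear_mode L d 1 (\<lambda>j. k j - m j) x)"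
      by (intro Bochner_Integration.integral_cong refl) (simp only: E_eq shear_mode_mult_cnj)
    also have "\<dots> = (if \<forall>j\<in>{1..d}. k j - m j = 0 then 1 else 0)"
      by (rule integral_shear_mode[OF L]) auto
    also have "(\<forall>j\<in>{1..d}. k j - m j = 0) \<longleftrightarrow> k = m"
      using km by (auto simp: int_lattice_def intro: PiE_ext)
    finally show "(LINT x|?M. E_fun d \<phi> k x * cnj (E_fun d \<phi> m x)) = (if k = m then 1 else 0)" .
  qed (simp add: E_eq)
  then show ?thesis by (simp add: cube_lebesgue_def unit_interval_def)
qed

end
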